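(* Let $(\phi,\eta,\xi,G)$ be a paracontact metric Finsler structure on a vector bundle $E$, and let $D$ be a Finsler connection on $E$. Then $(\phi,\eta,\xi,G)$ is a $K$-paracontact Finsler structure if and only if the following four conditions hold for all vector fields $X,Y$ on $E$: (i) $D^H_X\xi^H=-\frac12\phi X^H$; (ii) $G^H([\xi^H,X^V]^H,Y^H)=0$; (iii) $D^V_X\xi^V=-\frac12\phi X^V$; (iv) $G^V([\xi^V,X^H]^V,Y^V)=0$.
   Context: Setting. $(E,\pi,M)$ is a smooth vector bundle with $\dim M=n$ and fibre dimension $m$; $E$ also denotes the $(n+m)$-dimensional total space. $VE$ is the vertical bundle, and a nonlinear connection is fixed, i.e. a smooth distribution $HE$ on $E$ with $TE=HE\oplus VE$. For a vector field $X$ on $E$, $X^H$ and $X^V$ denote its horizontal and vertical components, so $X=X^H+X^V$. For a 1-form $\omega$ on $E$, $\omega^H(X)=\omega(X^H)$ and $\omega^V(X)=\omega(X^V)$. Almost paracontact Finsler structure. It is a triple $(\phi,\eta,\xi)$ where $\phi$ is a $(1,1)$-tensor field on $E$ with $\phi(HE)\subseteq HE$ and $\phi(VE)\subseteq VE$, $\eta$ is a 1-form on $E$ and $\xi$ is a vector field on $E$, such that $$\phi^2=I-\eta^H\otimes\xi^H-\eta^V\otimes\xi^V,\qquad \eta^H(\xi^H)=\eta^V(\xi^V)=1 .$$ Metric structures. A pseudo-metric structure on $E$ is a symmetric non-degenerate $(0,2)$-tensor $G=G^H+G^V$ with $G^H(X,Y)=G(X^H,Y^H)$ non-degenerate on $HE$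 and $G^V(X,Y)=G(X^V,Y^V)$ non-degenerate on $VE$. $(\phi,\eta,\xi,G)$ is an almost paracontact metric Finsler structure if $(\phi,\eta,\xi)$ is an almost paracontact Finsler structure and $$G^H(\phi X,\phi Y)=-G^H(X,Y)+\eta^H(X)\eta^H(Y),\quad G^V(\phi X,\phi Y)=-G^V(X,Y)+\eta^V(X)\eta^V(Y).$$ Its fundamental 2-form is $\Phi(X,Y)=G(X,\phi Y)$. It is a paracontact metric Finsler structure if $d\eta^H(X,Y)=\Phi(X^H,Y^H)$ and $d\eta^V(X,Y)=\Phi(X^V,Y^V)$ for all vector fields $X,Y$ on $E$, where $d\omega(X,Y)=X(\omega(Y))-Y(\omega(X))-\omega([X,Y])$ for a 1-form $\omega$. A paracontact metric Finsler structure is a $K$-paracontact Finsler structure if $\xi^H$ and $\xi^V$ are Killing with respect to $G^H$ and $G^V$ respectively, i.e. $\pounds_{\xi^H}G^H=0$ and $\pounds_{\xi^V}G^V=0$ as tensors on $E$. Finsler connection. A linear connection $D$ on $E$ is a d-connection if it preserves $HE$ and $VE$ by parallelism ($Dh=0=Dv$ for the projectors $h,v$ onto $HE,VE$). It is metrical if $D_XG=0$ for all $X$. It is symmetric if $D_{X^H}Y^H-D_{Y^H}X^H-[X^H,Y^H]^H=0$ and $D_{X^V}Y^V-D_{Y^V}X^V-[X^V,Y^V]^V=0$ for all $X,Y$. A Finsler connection is a symmetric metrical d-connection. Notation: $D^H_XY=D_{X^H}Y$, $D^V_XY=D_{X^V}Y$. *)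

theory Defs
  imports "HOL-Analysis.Analysis" "HOL-Library.Function_Algebras"
begin

text \<open>Pointwise scalar multiplication, so that \<open>span\<close>, \<open>independent\<close> and \<open>subspace\<close>
  apply to tangent vectors, which are functionals on smooth functions.\<close>

instantiation "fun" :: (type, real_vector) real_vector
begin

definition "scaleR c f = (\<lambda>x. c *\<^sub>R f x)"

instance
  by standard (simp_all add: scaleR_fun_def plus_fun_def algebra_simps)

end


section \<open>Smooth manifolds\<close>

text \<open>\<open>C\<^sup>k\<close> and smooth functions on an open subset of a Euclidean space.\<close>

primrec Ck_on :: "nat \<Rightarrow> 'a::euclidean_space set \<Rightarrow> ('a \<Rightarrow> 'b::real_normed_vector) \<Rightarrow> bool" where
  "Ck_on 0 = (\<lambda>S f. continuous_on S f)"
| "Ck_on (Suc k) = (\<lambda>S f. (\<forall>x\<in>S. f differentiable (at x)) \<and>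
      (\<forall>v. Ck_on k S (\<lambda>x. frechet_derivative f (at x) v)))"

definition smooth_on :: "'a::euclidean_space set \<Rightarrow> ('a \<Rightarrow> 'b::real_normed_vector) \<Rightarrow> bool" where
  "smooth_on S f \<longleftrightarrow> (\<forall>k. Ck_on k S f)"

text \<open>A chart is a pair of its domain and a map into the model space. A manifold is a
  topological space, given as a whole type (Hausdorff and second countable by its type
  classes), together with an atlas.\<close>

type_synonym ('a, 'b) chart = "'a set \<times> ('a \<Rightarrow> 'b)"

definition is_chart :: "('a::topological_space, 'b::euclidean_space) chart \<Rightarrow> bool" where
  "is_chart = (\<lambda>(W, c). open W \<and> open (c ` W) \<and> inj_on c W \<and>
     homeomorphism W (c ` W) c (inv_into W c))"

definition smooth_atlas :: "('a::topological_space, 'b::euclidean_space) chart set \<Rightarrow> bool" where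
  "smooth_atlas A \<longleftrightarrow> (\<forall>c\<in>A. is_chart c) \<and> (\<Union>(W, c)\<in>A. W) = UNIV \<and>
     (\<forall>(W, c)\<in>A. \<forall>(W', c')\<in>A. smooth_on (c ` (W \<inter> W')) (c' \<circ> inv_into W c))"

definition prod_atlas :: "('a, 'b) chart set \<Rightarrow> ('a \<times> 'f, 'b \<times> 'f) chart set" where
  "prod_atlas A = {(W \<times> UNIV, map_prod c id) |W c. (W, c) \<in> A}"

definition smooth_fun_on :: "('a::topological_space, 'b::euclidean_space) chart set \<Rightarrow>
    'a set \<Rightarrow> ('a \<Rightarrow> real) \<Rightarrow> bool" where
  "smooth_fun_on A S f \<longleftrightarrow> (\<forall>(W, c)\<in>A. smooth_on (c ` (S \<inter> W)) (f \<circ> inv_into W c))"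

definition smooth_funs :: "('a::topological_space, 'b::euclidean_space) chart set \<Rightarrow>
    ('a \<Rightarrow> real) set" where
  "smooth_funs A = {f. smooth_fun_on A UNIV f}"

definition smooth_map_on :: "('a::topological_space, 'b::euclidean_space) chart set \<Rightarrow>
    ('c::topological_space, 'd::euclidean_space) chart set \<Rightarrow> 'a set \<Rightarrow> ('a \<Rightarrow> 'c) \<Rightarrow> bool" where
  "smooth_map_on A A' S F \<longleftrightarrow> continuous_on S F \<and>
     (\<forall>(W, c)\<in>A. \<forall>(W', c')\<in>A'.
        smooth_on (c ` (S \<inter> W \<inter> F -` W')) (c' \<circ> F \<circ> inv_into W c))"

definition diffeo_on :: "('a::topological_space, 'b::euclidean_space) chart set \<Rightarrow>
    ('c::topological_space, 'd::euclidean_space) chart set \<Rightarrow>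
    'a set \<Rightarrow> 'c set \<Rightarrow> ('a \<Rightarrow> 'c) \<Rightarrow> bool" where
  "diffeo_on A A' S T F \<longleftrightarrow> open S \<and> open T \<and> bij_betw F S T \<and>
     smooth_map_on A A' S F \<and> smooth_map_on A' A T (inv_into S F)"


section \<open>Tangent vectors, vector fields, distributions\<close>

text \<open>A tangent vector at \<open>p\<close> is a derivation at \<open>p\<close> of the algebra of smooth functions, made
  extensional by the value 0 on non-smooth functions.\<close>

type_synonym 'a tangent = "('a \<Rightarrow> real) \<Rightarrow> real"

definition tangent_space :: "('a::topological_space, 'b::euclidean_space) chart set \<Rightarrow>
    'a \<Rightarrow> 'a tangent set" where
  "tangent_space A p = {v.
     (\<forall>f\<in>smooth_funs A. \<forall>g\<in>smooth_funs A. v (f + g) = v f + v g) \<and>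
     (\<forall>a. \<forall>f\<in>smooth_funs A. v (a *\<^sub>R f) = a * v f) \<and>
     (\<forall>f\<in>smooth_funs A. \<forall>g\<in>smooth_funs A. v (f * g) = f p * v g + g p * v f) \<and>
     (\<forall>f. f \<notin> smooth_funs A \<longrightarrow> v f = 0)}"

definition pushforward :: "('c::topological_space, 'd::euclidean_space) chart set \<Rightarrow>
    ('a \<Rightarrow> 'c) \<Rightarrow> 'a tangent \<Rightarrow> 'c tangent" where
  "pushforward A' F v = (\<lambda>f. if f \<in> smooth_funs A' then v (f \<circ> F) else 0)"

type_synonym 'a vfield = "'a \<Rightarrow> 'a tangent"

text \<open>The function \<open>X f\<close> for a vector field \<open>X\<close> and a function \<open>f\<close>.\<close>

definition act :: "'a vfield \<Rightarrow> ('a \<Rightarrow> real) \<Rightarrow> 'a \<Rightarrow> real" where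
  "act X f = (\<lambda>p. X p f)"

text \<open>Smooth vector fields along an open set. Since tangent vectors are local, testing against
  globally defined smooth functions suffices.\<close>

definition smooth_vfield_on :: "('a::topological_space, 'b::euclidean_space) chart set \<Rightarrow>
    'a set \<Rightarrow> 'a vfield \<Rightarrow> bool" where
  "smooth_vfield_on A S X \<longleftrightarrow> (\<forall>p\<in>S. X p \<in> tangent_space A p) \<and>
     (\<forall>f\<in>smooth_funs A. smooth_fun_on A S (act X f))"

definition vfields :: "('a::topological_space, 'b::euclidean_space) chart set \<Rightarrow>
    'a vfield set" where
  "vfields A = {X. smooth_vfield_on A UNIV X}"

definition fscale :: "('a \<Rightarrow> real) \<Rightarrow> 'a vfield \<Rightarrow> 'a vfield" (infixr "\<odot>" 75) where
  "f \<odot> X = (\<lambda>p. f p *\<^sub>R X p)"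

definition lie_bracket :: "('a::topological_space, 'b::euclidean_space) chart set \<Rightarrow>
    'a vfield \<Rightarrow> 'a vfield \<Rightarrow> 'a vfield" where
  "lie_bracket A X Y =
     (\<lambda>p f. if f \<in> smooth_funs A then X p (act Y f) - Y p (act X f) else 0)"

text \<open>A distribution assigns to each point a subspace of the tangent space; it is smooth of
  rank \<open>k\<close> if it has a smooth local frame of length \<open>k\<close> around every point.\<close>

type_synonym 'a distribution = "'a \<Rightarrow> 'a tangent set"

definition smooth_distribution :: "('a::topological_space, 'b::euclidean_space) chart set \<Rightarrow>
    nat \<Rightarrow> 'a distribution \<Rightarrow> bool" where
  "smooth_distribution A k P \<longleftrightarrow>
     (\<forall>p. \<exists>U e. open U \<and> p \<in> U \<and> (\<forall>i<k. smooth_vfield_on A U (e i)) \<and>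
        (\<forall>q\<in>U. inj_on (\<lambda>i. e i q) {..<k} \<and> independent ((\<lambda>i. e i q) ` {..<k}) \<and>
                span ((\<lambda>i. e i q) ` {..<k}) = P q))"

definition sections :: "('a::topological_space, 'b::euclidean_space) chart set \<Rightarrow>
    'a distribution \<Rightarrow> 'a vfield set" where
  "sections A P = {X \<in> vfields A. \<forall>p. X p \<in> P p}"

text \<open>The component in \<open>P\<close> of a vector field with respect to a decomposition \<open>P \<oplus> Q\<close>.\<close>

definition component :: "'a distribution \<Rightarrow> 'a distribution \<Rightarrow> 'a vfield \<Rightarrow> 'a vfield" where
  "component P Q X = (\<lambda>p. THE u. u \<in> P p \<and> X p - u \<in> Q p)"


section \<open>Tensor fields and linear connections\<close>

text \<open>Tensor fields are multilinear maps, over the algebra of smooth functions, on the module of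
  global smooth vector fields. Their values off that module are irrelevant.\<close>

definition one_form :: "('a::topological_space, 'b::euclidean_space) chart set \<Rightarrow>
    ('a vfield \<Rightarrow> 'a \<Rightarrow> real) \<Rightarrow> bool" where
  "one_form A \<omega> \<longleftrightarrow>
     (\<forall>X\<in>vfields A. \<omega> X \<in> smooth_funs A) \<and>
     (\<forall>X\<in>vfields A. \<forall>Y\<in>vfields A. \<omega> (X + Y) = \<omega> X + \<omega> Y) \<and>
     (\<forall>f\<in>smooth_funs A. \<forall>X\<in>vfields A. \<omega> (f \<odot> X) = f * \<omega> X)"

definition tensor11 :: "('a::topological_space, 'b::euclidean_space) chart set \<Rightarrow>
    ('a vfield \<Rightarrow> 'a vfield) \<Rightarrow> bool" where
  "tensor11 A \<phi> \<longleftrightarrow>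
     (\<forall>X\<in>vfields A. \<phi> X \<in> vfields A) \<and>
     (\<forall>X\<in>vfields A. \<forall>Y\<in>vfields A. \<phi> (X + Y) = \<phi> X + \<phi> Y) \<and>
     (\<forall>f\<in>smooth_funs A. \<forall>X\<in>vfields A. \<phi> (f \<odot> X) = f \<odot> \<phi> X)"

definition tensor02 :: "('a::topological_space, 'b::euclidean_space) chart set \<Rightarrow>
    ('a vfield \<Rightarrow> 'a vfield \<Rightarrow> 'a \<Rightarrow> real) \<Rightarrow> bool" where
  "tensor02 A G \<longleftrightarrow> (\<forall>X\<in>vfields A. one_form A (G X) \<and> one_form A (\<lambda>Y. G Y X))"

text \<open>Pointwise non-degeneracy on a subbundle \<open>P\<close> of the tangent bundle: \<open>G X Y p\<close> depends only
  on \<open>X p\<close> and \<open>Y p\<close>, and every vector in \<open>P p\<close> is the value at \<open>p\<close> of a section of \<open>P\<close>.\<close>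

definition nondegenerate_on :: "('a::topological_space, 'b::euclidean_space) chart set \<Rightarrow>
    'a distribution \<Rightarrow> ('a vfield \<Rightarrow> 'a vfield \<Rightarrow> 'a \<Rightarrow> real) \<Rightarrow> bool" where
  "nondegenerate_on A P G \<longleftrightarrow>
     (\<forall>p. \<forall>X\<in>sections A P. (\<forall>Y\<in>sections A P. G X Y p = 0) \<longrightarrow> X p = 0)"

definition ext_deriv :: "('a::topological_space, 'b::euclidean_space) chart set \<Rightarrow>
    ('a vfield \<Rightarrow> 'a \<Rightarrow> real) \<Rightarrow> 'a vfield \<Rightarrow> 'a vfield \<Rightarrow> 'a \<Rightarrow> real" where
  "ext_deriv A \<omega> X Y = act X (\<omega> Y) - act Y (\<omega> X) - \<omega> (lie_bracket A X Y)"

definition lie_deriv02 :: "('a::topological_space, 'b::euclidean_space) chart set \<Rightarrow>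
    'a vfield \<Rightarrow> ('a vfield \<Rightarrow> 'a vfield \<Rightarrow> 'a \<Rightarrow> real) \<Rightarrow>
    'a vfield \<Rightarrow> 'a vfield \<Rightarrow> 'a \<Rightarrow> real" where
  "lie_deriv02 A Z G X Y =
     act Z (G X Y) - G (lie_bracket A Z X) Y - G X (lie_bracket A Z Y)"

definition Killing :: "('a::topological_space, 'b::euclidean_space) chart set \<Rightarrow>
    'a vfield \<Rightarrow> ('a vfield \<Rightarrow> 'a vfield \<Rightarrow> 'a \<Rightarrow> real) \<Rightarrow> bool" where
  "Killing A Z G \<longleftrightarrow> (\<forall>X\<in>vfields A. \<forall>Y\<in>vfields A. lie_deriv02 A Z G X Y = 0)"

definition linear_connection :: "('a::topological_space, 'b::euclidean_space) chart set \<Rightarrow>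
    ('a vfield \<Rightarrow> 'a vfield \<Rightarrow> 'a vfield) \<Rightarrow> bool" where
  "linear_connection A D \<longleftrightarrow>
     (\<forall>X\<in>vfields A. \<forall>Y\<in>vfields A. D X Y \<in> vfields A) \<and>
     (\<forall>X\<in>vfields A. \<forall>Y\<in>vfields A. \<forall>Z\<in>vfields A.
        D (X + Y) Z = D X Z + D Y Z \<and> D X (Y + Z) = D X Y + D X Z) \<and>
     (\<forall>f\<in>smooth_funs A. \<forall>X\<in>vfields A. \<forall>Y\<in>vfields A.
        D (f \<odot> X) Y = f \<odot> D X Y \<and> D X (f \<odot> Y) = act X f \<odot> Y + f \<odot> D X Y)"

definition cov_deriv11 :: "('a vfield \<Rightarrow> 'a vfield \<Rightarrow> 'a vfield) \<Rightarrow> 'a vfield \<Rightarrow>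
    ('a vfield \<Rightarrow> 'a vfield) \<Rightarrow> 'a vfield \<Rightarrow> 'a vfield" where
  "cov_deriv11 D X T Y = D X (T Y) - T (D X Y)"

definition cov_deriv02 :: "('a vfield \<Rightarrow> 'a vfield \<Rightarrow> 'a vfield) \<Rightarrow> 'a vfield \<Rightarrow>
    ('a vfield \<Rightarrow> 'a vfield \<Rightarrow> 'a \<Rightarrow> real) \<Rightarrow> 'a vfield \<Rightarrow> 'a vfield \<Rightarrow> 'a \<Rightarrow> real" where
  "cov_deriv02 D X G Y Z = act X (G Y Z) - G (D X Y) Z - G Y (D X Z)"


section \<open>Vector bundles and nonlinear connections\<close>

text \<open>The base is modelled on \<open>'b\<close>, the typical fibre is \<open>'f\<close>, and the total space is modelled on
  \<open>'b \<times> 'f\<close>; hence \<open>n = DIM('b)\<close> and \<open>m = DIM('f)\<close>.\<close>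

record ('e, 'm, 'b, 'f) vbundle =
  total_atlas :: "('e, 'b \<times> 'f) chart set"
  base_atlas :: "('m, 'b) chart set"
  bproj :: "'e \<Rightarrow> 'm"
  fibre_add :: "'e \<Rightarrow> 'e \<Rightarrow> 'e"
  fibre_scale :: "real \<Rightarrow> 'e \<Rightarrow> 'e"

definition local_trivialization ::
    "('e::topological_space, 'm::topological_space, 'b::euclidean_space, 'f::euclidean_space) vbundle \<Rightarrow>
     'm set \<Rightarrow> ('e \<Rightarrow> 'f) \<Rightarrow> bool" where
  "local_trivialization B U \<tau> \<longleftrightarrow> open U \<and>
     diffeo_on (total_atlas B) (prod_atlas (base_atlas B)) (bproj B -` U) (U \<times> UNIV)
       (\<lambda>x. (bproj B x, \<tau> x)) \<and>
     (\<forall>x y. bproj B x \<in> U \<and> bproj B y = bproj B x \<longrightarrow> \<tau> (fibre_add B x y) = \<tau> x + \<tau> y) \<and>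
     (\<forall>a x. bproj B x \<in> U \<longrightarrow> \<tau> (fibre_scale B a x) = a *\<^sub>R \<tau> x)"

text \<open>The vector space laws on the fibres need not be listed: the trivializations, being
  fibrewise bijective, transport them from \<open>'f\<close>.\<close>

definition smooth_vector_bundle ::
    "('e::topological_space, 'm::topological_space, 'b::euclidean_space, 'f::euclidean_space) vbundle \<Rightarrow> bool" where
  "smooth_vector_bundle B \<longleftrightarrow>
     smooth_atlas (total_atlas B) \<and> smooth_atlas (base_atlas B) \<and>
     smooth_map_on (total_atlas B) (base_atlas B) UNIV (bproj B) \<and>
     (\<forall>x y. bproj B y = bproj B x \<longrightarrow> bproj B (fibre_add B x y) = bproj B x) \<and>
     (\<forall>a x. bproj B (fibre_scale B a x) = bproj B x) \<and>
     (\<forall>p. \<exists>U \<tau>. p \<in> U \<and> local_trivialization B U \<tau>)"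

definition vertical ::
    "('e::topological_space, 'm::topological_space, 'b::euclidean_space, 'f::euclidean_space) vbundle \<Rightarrow>
     'e distribution" where
  "vertical B p = {v \<in> tangent_space (total_atlas B) p. pushforward (base_atlas B) (bproj B) v = 0}"

definition nonlinear_connection ::
    "('e::topological_space, 'm::topological_space, 'b::euclidean_space, 'f::euclidean_space) vbundle \<Rightarrow>
     'e distribution \<Rightarrow> bool" where
  "nonlinear_connection B H \<longleftrightarrow> smooth_distribution (total_atlas B) DIM('b) H \<and>
     (\<forall>p. H p \<subseteq> tangent_space (total_atlas B) p \<and> H p \<inter> vertical B p = {0} \<and>
          tangent_space (total_atlas B) p = {u + w |u w. u \<in> H p \<and> w \<in> vertical B p})"

definition hor ::
    "('e::topological_space, 'm::topological_space, 'b::euclidean_space, 'f::euclidean_space) vbundle \<Rightarrow>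
     'e distribution \<Rightarrow> 'e vfield \<Rightarrow> 'e vfield" where
  "hor B H = component H (vertical B)"

definition ver ::
    "('e::topological_space, 'm::topological_space, 'b::euclidean_space, 'f::euclidean_space) vbundle \<Rightarrow>
     'e distribution \<Rightarrow> 'e vfield \<Rightarrow> 'e vfield" where
  "ver B H = component (vertical B) H"

abbreviation tvfields ::
    "('e::topological_space, 'm::topological_space, 'b::euclidean_space, 'f::euclidean_space) vbundle \<Rightarrow>
     'e vfield set" where
  "tvfields B \<equiv> vfields (total_atlas B)"

abbreviation tbracket ::
    "('e::topological_space, 'm::topological_space, 'b::euclidean_space, 'f::euclidean_space) vbundle \<Rightarrow>
     'e vfield \<Rightarrow> 'e vfield \<Rightarrow> 'e vfield" where
  "tbracket B \<equiv> lie_bracket (total_atlas B)"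


section \<open>Almost paracontact Finsler structures\<close>

definition almost_paracontact_Finsler ::
    "('e::topological_space, 'm::topological_space, 'b::euclidean_space, 'f::euclidean_space) vbundle \<Rightarrow>
     'e distribution \<Rightarrow> ('e vfield \<Rightarrow> 'e vfield) \<Rightarrow> ('e vfield \<Rightarrow> 'e \<Rightarrow> real) \<Rightarrow> 'e vfield \<Rightarrow> bool" where
  "almost_paracontact_Finsler B H \<phi> \<eta> \<xi> \<longleftrightarrow>
     tensor11 (total_atlas B) \<phi> \<and> one_form (total_atlas B) \<eta> \<and> \<xi> \<in> tvfields B \<and>
     \<phi> ` sections (total_atlas B) H \<subseteq> sections (total_atlas B) H \<and>
     \<phi> ` sections (total_atlas B) (vertical B) \<subseteq> sections (total_atlas B) (vertical B) \<and>
     (\<forall>X\<in>tvfields B. \<phi> (\<phi> X) =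
        X - \<eta> (hor B H X) \<odot> hor B H \<xi> - \<eta> (ver B H X) \<odot> ver B H \<xi>) \<and>
     \<eta> (hor B H (hor B H \<xi>)) = 1 \<and> \<eta> (ver B H (ver B H \<xi>)) = 1"

definition GH ::
    "('e::topological_space, 'm::topological_space, 'b::euclidean_space, 'f::euclidean_space) vbundle \<Rightarrow>
     'e distribution \<Rightarrow> ('e vfield \<Rightarrow> 'e vfield \<Rightarrow> 'e \<Rightarrow> real) \<Rightarrow>
     'e vfield \<Rightarrow> 'e vfield \<Rightarrow> 'e \<Rightarrow> real" where
  "GH B H G X Y = G (hor B H X) (hor B H Y)"

definition GV ::
    "('e::topological_space, 'm::topological_space, 'b::euclidean_space, 'f::euclidean_space) vbundle \<Rightarrow>
     'e distribution \<Rightarrow> ('e vfield \<Rightarrow> 'e vfield \<Rightarrow> 'e \<Rightarrow> real) \<Rightarrow>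
     'e vfield \<Rightarrow> 'e vfield \<Rightarrow> 'e \<Rightarrow> real" where
  "GV B H G X Y = G (ver B H X) (ver B H Y)"

definition pseudo_metric_structure ::
    "('e::topological_space, 'm::topological_space, 'b::euclidean_space, 'f::euclidean_space) vbundle \<Rightarrow>
     'e distribution \<Rightarrow> ('e vfield \<Rightarrow> 'e vfield \<Rightarrow> 'e \<Rightarrow> real) \<Rightarrow> bool" where
  "pseudo_metric_structure B H G \<longleftrightarrow>
     tensor02 (total_atlas B) G \<and>
     (\<forall>X\<in>tvfields B. \<forall>Y\<in>tvfields B. G X Y = G Y X) \<and>
     nondegenerate_on (total_atlas B) (tangent_space (total_atlas B)) G \<and>
     (\<forall>X\<in>tvfields B. \<forall>Y\<in>tvfields B. G X Y = GH B H G X Y + GV B H G X Y) \<and>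
     nondegenerate_on (total_atlas B) H (GH B H G) \<and>
     nondegenerate_on (total_atlas B) (vertical B) (GV B H G)"

definition almost_paracontact_metric_Finsler ::
    "('e::topological_space, 'm::topological_space, 'b::euclidean_space, 'f::euclidean_space) vbundle \<Rightarrow>
     'e distribution \<Rightarrow> ('e vfield \<Rightarrow> 'e vfield) \<Rightarrow> ('e vfield \<Rightarrow> 'e \<Rightarrow> real) \<Rightarrow> 'e vfield \<Rightarrow>
     ('e vfield \<Rightarrow> 'e vfield \<Rightarrow> 'e \<Rightarrow> real) \<Rightarrow> bool" where
  "almost_paracontact_metric_Finsler B H \<phi> \<eta> \<xi> G \<longleftrightarrow>
     almost_paracontact_Finsler B H \<phi> \<eta> \<xi> \<and> pseudo_metric_structure B H G \<and>
     (\<forall>X\<in>tvfields B. \<forall>Y\<in>tvfields B.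
        GH B H G (\<phi> X) (\<phi> Y) = - GH B H G X Y + \<eta> (hor B H X) * \<eta> (hor B H Y) \<and>
        GV B H G (\<phi> X) (\<phi> Y) = - GV B H G X Y + \<eta> (ver B H X) * \<eta> (ver B H Y))"

definition fundamental_form :: "('e vfield \<Rightarrow> 'e vfield) \<Rightarrow>
    ('e vfield \<Rightarrow> 'e vfield \<Rightarrow> 'e \<Rightarrow> real) \<Rightarrow> 'e vfield \<Rightarrow> 'e vfield \<Rightarrow> 'e \<Rightarrow> real" where
  "fundamental_form \<phi> G X Y = G X (\<phi> Y)"

definition paracontact_metric_Finsler ::
    "('e::topological_space, 'm::topological_space, 'b::euclidean_space, 'f::euclidean_space) vbundle \<Rightarrow>
     'e distribution \<Rightarrow> ('e vfield \<Rightarrow> 'e vfield) \<Rightarrow> ('e vfield \<Rightarrow> 'e \<Rightarrow> real) \<Rightarrow> 'e vfield \<Rightarrow>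
     ('e vfield \<Rightarrow> 'e vfield \<Rightarrow> 'e \<Rightarrow> real) \<Rightarrow> bool" where
  "paracontact_metric_Finsler B H \<phi> \<eta> \<xi> G \<longleftrightarrow>
     almost_paracontact_metric_Finsler B H \<phi> \<eta> \<xi> G \<and>
     (\<forall>X\<in>tvfields B. \<forall>Y\<in>tvfields B.
        ext_deriv (total_atlas B) (\<lambda>Z. \<eta> (hor B H Z)) X Y =
          fundamental_form \<phi> G (hor B H X) (hor B H Y) \<and>
        ext_deriv (total_atlas B) (\<lambda>Z. \<eta> (ver B H Z)) X Y =
          fundamental_form \<phi> G (ver B H X) (ver B H Y))"

definition K_paracontact_Finsler ::
    "('e::topological_space, 'm::topological_space, 'b::euclidean_space, 'f::euclidean_space) vbundle \<Rightarrow>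
     'e distribution \<Rightarrow> ('e vfield \<Rightarrow> 'e vfield) \<Rightarrow> ('e vfield \<Rightarrow> 'e \<Rightarrow> real) \<Rightarrow> 'e vfield \<Rightarrow>
     ('e vfield \<Rightarrow> 'e vfield \<Rightarrow> 'e \<Rightarrow> real) \<Rightarrow> bool" where
  "K_paracontact_Finsler B H \<phi> \<eta> \<xi> G \<longleftrightarrow>
     paracontact_metric_Finsler B H \<phi> \<eta> \<xi> G \<and>
     Killing (total_atlas B) (hor B H \<xi>) (GH B H G) \<and>
     Killing (total_atlas B) (ver B H \<xi>) (GV B H G)"


section \<open>Finsler connections\<close>

definition d_connection ::
    "('e::topological_space, 'm::topological_space, 'b::euclidean_space, 'f::euclidean_space) vbundle \<Rightarrow>
     'e distribution \<Rightarrow> ('e vfield \<Rightarrow> 'e vfield \<Rightarrow> 'e vfield) \<Rightarrow> bool" where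
  "d_connection B H D \<longleftrightarrow> linear_connection (total_atlas B) D \<and>
     (\<forall>X\<in>tvfields B. \<forall>Y\<in>tvfields B.
        cov_deriv11 D X (hor B H) Y = 0 \<and> cov_deriv11 D X (ver B H) Y = 0)"

definition metrical_connection ::
    "('e::topological_space, 'm::topological_space, 'b::euclidean_space, 'f::euclidean_space) vbundle \<Rightarrow>
     ('e vfield \<Rightarrow> 'e vfield \<Rightarrow> 'e \<Rightarrow> real) \<Rightarrow> ('e vfield \<Rightarrow> 'e vfield \<Rightarrow> 'e vfield) \<Rightarrow> bool" where
  "metrical_connection B G D \<longleftrightarrow>
     (\<forall>X\<in>tvfields B. \<forall>Y\<in>tvfields B. \<forall>Z\<in>tvfields B. cov_deriv02 D X G Y Z = 0)"

definition symmetric_connection ::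
    "('e::topological_space, 'm::topological_space, 'b::euclidean_space, 'f::euclidean_space) vbundle \<Rightarrow>
     'e distribution \<Rightarrow> ('e vfield \<Rightarrow> 'e vfield \<Rightarrow> 'e vfield) \<Rightarrow> bool" where
  "symmetric_connection B H D \<longleftrightarrow>
     (\<forall>X\<in>tvfields B. \<forall>Y\<in>tvfields B.
        D (hor B H X) (hor B H Y) - D (hor B H Y) (hor B H X)
          - hor B H (tbracket B (hor B H X) (hor B H Y)) = 0 \<and>
        D (ver B H X) (ver B H Y) - D (ver B H Y) (ver B H X)
          - ver B H (tbracket B (ver B H X) (ver B H Y)) = 0)"

definition Finsler_connection ::
    "('e::topological_space, 'm::topological_space, 'b::euclidean_space, 'f::euclidean_space) vbundle \<Rightarrow>
     'e distribution \<Rightarrow> ('e vfield \<Rightarrow> 'e vfield \<Rightarrow> 'e \<Rightarrow> real) \<Rightarrow>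
     ('e vfield \<Rightarrow> 'e vfield \<Rightarrow> 'e vfield) \<Rightarrow> bool" where
  "Finsler_connection B H G D \<longleftrightarrow>
     d_connection B H D \<and> metrical_connection B G D \<and> symmetric_connection B H D"

end

theory Submission
  imports Defs
begin

text \<open>The horizontal and the vertical halves of the theorem are the same statement about one summand
  \<open>P\<close> of a splitting \<open>TE = P \<oplus> Q\<close>, once with \<open>P = HE\<close>, \<open>Q = VE\<close> and once with the roles exchanged.
  Let \<open>Z\<close> be the \<open>P\<close>-component of \<open>\<xi>\<close>, \<open>G\<^sub>P\<close> the restriction of the metric to \<open>P\<close>, and write \<open>pr\<close> and
  \<open>co\<close> for the projections onto \<open>P\<close> and \<open>Q\<close>.

  For sections \<open>X, Y\<close> of \<open>P\<close>, metricity and symmetry of \<open>D\<close> turn the contact condition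
  \<open>d\<eta>(X, Y) = G(X, \<phi> Y)\<close> into \<open>G(X, \<phi> Y) = G(Y, D\<^sub>X Z) - G(X, D\<^sub>Y Z)\<close>, because \<open>\<eta>\<close> is the metric dual
  of \<open>Z\<close> on \<open>P\<close>. So \<open>-\<phi>/2\<close> is the part of \<open>X \<mapsto> D\<^sub>X Z\<close> that is skew with respect to \<open>G\<^sub>P\<close>.
  The Lie derivative of \<open>G\<^sub>P\<close> along \<open>Z\<close> is
  \<open>G(D\<^bsub>pr X\<^esub> Z, pr Y) + G(pr X, D\<^bsub>pr Y\<^esub> Z) - G(pr [Z, co X], pr Y) - G(pr X, pr [Z, co Y])\<close>.
  On \<open>P \<times> P\<close> only the first two terms are present; they are twice the symmetric part of
  \<open>X \<mapsto> D\<^sub>X Z\<close>, which vanishes iff \<open>D\<^sub>X Z = -\<phi> X/2\<close>. On \<open>Q \<times> P\<close> only the third term is present, which gives the bracket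
  conditions. This is \<open>Killing_iff\<close> in the locale \<open>paracontact_subbundle\<close>; it rests on
  \<open>\<Phi>_eq_D\<close> and \<open>lie_deriv_G\<close>.

  Since tensors and connections act on smooth vector fields, all this needs the components
  \<open>X\<^sup>H\<close> and \<open>X\<^sup>V\<close> of a smooth field \<open>X\<close> to be smooth again (\<open>component_smooth\<close>). Here it matters that
  the vertical bundle is cut out by functions: \<open>v\<close> is vertical iff \<open>v (f \<circ> \<pi>) = 0\<close> for every smooth \<open>f\<close>
  on the base. As \<open>HE\<close> meets \<open>VE\<close> only in 0, these functions separate horizontal vectors, so a
  smooth local frame of \<open>HE\<close> can be reduced by Gaussian elimination to a frame \<open>e\<^sub>1, \<dots>, e\<^sub>n\<close> with
  \<open>e\<^sub>i (f\<^sub>j \<circ> \<pi>) = \<delta>\<^sub>i\<^sub>j\<close>. Then \<open>X\<^sup>H = \<Sum>\<^sub>j X (f\<^sub>j \<circ> \<pi>) e\<^sub>j\<close> near the given point, with smooth coefficients.\<close>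

section \<open>Smooth functions\<close>

lemma Ck_on_subset:
  "Ck_on k S f \<Longrightarrow> T \<subseteq> S \<Longrightarrow> Ck_on k T f"
  by (induction k arbitrary: f) (auto intro: continuous_on_subset)

text \<open>Openness of \<open>S\<close> is essential: agreement on \<open>S\<close> gives equal derivatives only at interior points.\<close>

lemma Ck_on_cong:
  assumes "open S" "\<And>x. x \<in> S \<Longrightarrow> f x = g x" "Ck_on k S f"
  shows "Ck_on k S g"
  using assms(2,3)
proof (induction k arbitrary: f g)
  case 0
  then show ?case by (simp add: continuous_on_eq)
next
  case (Suc k)
  have d: "f differentiable (at x)" if "x \<in> S" for x
    using Suc.prems(2) that by simp
  have g: "(g has_derivative frechet_derivative f (at x)) (at x)" if "x \<in> S" for x
    using has_derivative_transform_within_open[OF _ assms(1) that Suc.prems(1)] d[OF that]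
    by (simp add: frechet_derivative_works)
  have e: "frechet_derivative f (at x) v = frechet_derivative g (at x) v" if "x \<in> S" for x v
    using frechet_derivative_at[OF g[OF that]] by simp
  have "Ck_on k S (\<lambda>x. frechet_derivative g (at x) v)" for v
    by (rule Suc.IH[of "\<lambda>x. frechet_derivative f (at x) v"]) (use e Suc.prems(2) in auto)
  moreover have "g differentiable (at x)" if "x \<in> S" for x
    using g[OF that] by (auto simp: differentiable_def)
  ultimately show ?case by simp
qed

lemma Ck_on_Suc_imp: "Ck_on (Suc k) S f \<Longrightarrow> Ck_on k S f"
proof (induction k arbitrary: f)
  case 0
  then show ?case
    by (auto intro!: continuous_at_imp_continuous_on differentiable_imp_continuous_within)
next
  case (Suc k)
  from Suc.prems show ?case
    by (subst Ck_on.simps(2), subst (asm) Ck_on.simps(2)) (blast intro: Suc.IH)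
qed

text \<open>Any explicit formula for the derivative may replace \<^const>\<open>frechet_derivative\<close> in the recursion.\<close>

lemma Ck_on_SucI:
  assumes "open S" "\<And>x. x \<in> S \<Longrightarrow> (f has_derivative f' x) (at x)"
    and "\<And>v. Ck_on k S (\<lambda>x. f' x v)"
  shows "Ck_on (Suc k) S f"
proof -
  have "Ck_on k S (\<lambda>x. frechet_derivative f (at x) v)" for v
    by (rule Ck_on_cong[OF assms(1) _ assms(3)[of v]])
      (simp add: frechet_derivative_at[OF assms(2), symmetric])
  then show ?thesis using assms(2) by (auto simp: differentiable_def)
qed

lemma Ck_on_SucD:
  assumes "Ck_on (Suc k) S f"
  shows "x \<in> S \<Longrightarrow> (f has_derivative frechet_derivative f (at x)) (at x)"
    and "Ck_on k S (\<lambda>x. frechet_derivative f (at x) v)"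
  using assms by (auto simp: frechet_derivative_works)

lemma Ck_on_const: "open S \<Longrightarrow> Ck_on k S (\<lambda>_. c)"
proof (induction k arbitrary: c)
  case (Suc k)
  show ?case by (rule Ck_on_SucI[where f' = "\<lambda>_ _. 0"]) (use Suc in auto)
qed simp

lemma Ck_on_add:
  assumes "open S"
  shows "Ck_on k S f \<Longrightarrow> Ck_on k S g \<Longrightarrow> Ck_on k S (\<lambda>x. f x + g x)"
proof (induction k arbitrary: f g)
  case (Suc k)
  show ?case
    by (rule Ck_on_SucI[OF assms has_derivative_add[OF Ck_on_SucD(1)[OF Suc.prems(1)]
          Ck_on_SucD(1)[OF Suc.prems(2)]]])
      (auto intro!: Suc.IH Ck_on_SucD(2)[OF Suc.prems(1)] Ck_on_SucD(2)[OF Suc.prems(2)])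
qed (simp add: continuous_on_add)

text \<open>The product rule involves the undifferentiated factors, whence the appeal to
  \<open>Ck_on_Suc_imp\<close> at the lower order; the same happens for the inverse.\<close>

lemma Ck_on_mult:
  fixes f g :: "'a::euclidean_space \<Rightarrow> real"
  assumes "open S"
  shows "Ck_on k S f \<Longrightarrow> Ck_on k S g \<Longrightarrow> Ck_on k S (\<lambda>x. f x * g x)"
proof (induction k arbitrary: f g)
  case (Suc k)
  show ?case
    by (rule Ck_on_SucI[OF assms has_derivative_mult[OF Ck_on_SucD(1)[OF Suc.prems(1)]
          Ck_on_SucD(1)[OF Suc.prems(2)]]])
      (auto intro!: Ck_on_add assms Suc.IH Ck_on_SucD(2)[OF Suc.prems(1)]
        Ck_on_SucD(2)[OF Suc.prems(2)] Ck_on_Suc_imp[OF Suc.prems(1)] Ck_on_Suc_imp[OF Suc.prems(2)])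
qed (simp add: continuous_on_mult)

lemma Ck_on_inverse:
  fixes f :: "'a::euclidean_space \<Rightarrow> real"
  assumes "open S" and nz: "\<And>x. x \<in> S \<Longrightarrow> f x \<noteq> 0"
  shows "Ck_on k S f \<Longrightarrow> Ck_on k S (\<lambda>x. inverse (f x))"
proof (induction k)
  case 0
  then show ?case using nz by (auto intro: continuous_on_inverse)
next
  case (Suc k)
  have inv: "Ck_on k S (\<lambda>x. inverse (f x))"
    using Suc.IH Ck_on_Suc_imp[OF Suc.prems] by blast
  have "Ck_on k S (\<lambda>x. -1 * (inverse (f x) * frechet_derivative f (at x) v * inverse (f x)))" for v
    by (intro Ck_on_mult Ck_on_const assms(1) inv Ck_on_SucD(2)[OF Suc.prems])
  then show ?case
    by (intro Ck_on_SucI[OF assms(1) Deriv.has_derivative_inverse[OF nz Ck_on_SucD(1)[OF Suc.prems]]]) auto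
qed

lemma Ck_on_local:
  assumes "\<And>x. x \<in> S \<Longrightarrow> \<exists>T. open T \<and> x \<in> T \<and> Ck_on k T f"
  shows "Ck_on k S f"
  using assms
proof (induction k arbitrary: f)
  case 0
  have "isCont f x" if "x \<in> S" for x
    using 0[OF that] by (auto simp: continuous_on_eq_continuous_at)
  then show ?case by (auto intro: continuous_at_imp_continuous_on)
next
  case (Suc k)
  have "f differentiable (at x)" if "x \<in> S" for x
    using Suc.prems[OF that] by auto
  moreover have "Ck_on k S (\<lambda>x. frechet_derivative f (at x) v)" for v
    by (rule Suc.IH) (use Suc.prems in fastforce)
  ultimately show ?case by simp
qed

lemma chart_properties:
  assumes "smooth_atlas A" "(W, c) \<in> A"
  shows "open W" "continuous_on W c" "inj_on c W"
    and "open S \<Longrightarrow> open (c ` (S \<inter> W))"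
proof -
  have ch: "is_chart (W, c)" using assms by (auto simp: smooth_atlas_def)
  then show W: "open W" "continuous_on W c" "inj_on c W"
    by (auto simp: is_chart_def homeomorphism_def)
  have h: "homeomorphism W (c ` W) c (inv_into W c)" "open (c ` W)"
    using ch by (auto simp: is_chart_def)
  assume "open S"
  then have "openin (top_of_set W) (S \<inter> W)" by (metis Int_commute openin_open_Int)
  then have "openin (top_of_set (c ` W)) (c ` (S \<inter> W))"
    using homeomorphism_imp_open_map[OF h(1)] by blast
  then show "open (c ` (S \<inter> W))" using h(2) openin_open_trans by blast
qed

lemma smooth_fun_on_const:
  "smooth_atlas A \<Longrightarrow> open S \<Longrightarrow> smooth_fun_on A S (\<lambda>_. a)"
  by (auto simp: smooth_fun_on_def smooth_on_def o_def intro!: Ck_on_const chart_properties(4))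

lemma smooth_fun_on_add:
  "smooth_atlas A \<Longrightarrow> open S \<Longrightarrow> smooth_fun_on A S f \<Longrightarrow> smooth_fun_on A S g
    \<Longrightarrow> smooth_fun_on A S (\<lambda>p. f p + g p)"
  unfolding smooth_fun_on_def smooth_on_def o_def
  by (fastforce intro!: Ck_on_add chart_properties(4))

lemma smooth_fun_on_mult:
  "smooth_atlas A \<Longrightarrow> open S \<Longrightarrow> smooth_fun_on A S f \<Longrightarrow> smooth_fun_on A S g
    \<Longrightarrow> smooth_fun_on A S (\<lambda>p. f p * g p)"
  unfolding smooth_fun_on_def smooth_on_def o_def
  by (fastforce intro!: Ck_on_mult chart_properties(4))

lemma smooth_fun_on_inverse:
  "smooth_atlas A \<Longrightarrow> open S \<Longrightarrow> (\<And>p. p \<in> S \<Longrightarrow> f p \<noteq> 0) \<Longrightarrow> smooth_fun_on A S f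
    \<Longrightarrow> smooth_fun_on A S (\<lambda>p. inverse (f p))"
  unfolding smooth_fun_on_def smooth_on_def o_def
  by (fastforce intro!: Ck_on_inverse chart_properties(4) simp: chart_properties(3))

lemma smooth_fun_on_diff:
  assumes "smooth_atlas A" "open S" "smooth_fun_on A S f" "smooth_fun_on A S g"
  shows "smooth_fun_on A S (\<lambda>p. f p - g p)"
  using smooth_fun_on_add[OF assms(1-3)
      smooth_fun_on_mult[OF assms(1,2) smooth_fun_on_const[OF assms(1,2), of "-1"] assms(4)]]
  by simp

lemma smooth_fun_on_subset:
  "smooth_fun_on A S f \<Longrightarrow> T \<subseteq> S \<Longrightarrow> smooth_fun_on A T f"
  unfolding smooth_fun_on_def smooth_on_def by (fastforce intro: Ck_on_subset)

lemma smooth_fun_on_local: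
  assumes A: "smooth_atlas A"
    and loc: "\<And>p. p \<in> S \<Longrightarrow> \<exists>U. open U \<and> p \<in> U \<and> smooth_fun_on A U f"
  shows "smooth_fun_on A S f"
  unfolding smooth_fun_on_def smooth_on_def
proof clarify
  fix W c k assume Wc: "(W, c) \<in> A"
  show "Ck_on k (c ` (S \<inter> W)) (f \<circ> inv_into W c)"
  proof (rule Ck_on_local)
    fix y assume "y \<in> c ` (S \<inter> W)"
    then obtain p where p: "p \<in> S" "p \<in> W" "y = c p" by auto
    then obtain U where "open U" "p \<in> U" "smooth_fun_on A U f" using loc by blast
    then show "\<exists>T. open T \<and> y \<in> T \<and> Ck_on k T (f \<circ> inv_into W c)"
      using Wc p chart_properties(4)[OF A Wc, of U]
      by (intro exI[of _ "c ` (U \<inter> W)"]) (auto simp: smooth_fun_on_def smooth_on_def)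
  qed
qed

text \<open>The smoothness predicate only speaks of coordinate expressions; continuity on the
  manifold comes from the continuity of the charts. It is needed to know that a function that is
  nonzero at a point stays nonzero nearby.\<close>

lemma smooth_fun_on_continuous:
  assumes A: "smooth_atlas A" and "open S" and f: "smooth_fun_on A S f"
  shows "continuous_on S f"
proof -
  have "continuous_on (S \<inter> fst C) f" if "C \<in> A" for C
  proof -
    obtain W c where C: "C = (W, c)" by fastforce
    with that have Wc: "(W, c) \<in> A" by simp
    note ch = chart_properties[OF A Wc]
    have "Ck_on 0 (c ` (S \<inter> W)) (f \<circ> inv_into W c)"
      using f Wc unfolding smooth_fun_on_def smooth_on_def by blast
    then have "continuous_on (c ` (S \<inter> W)) (f \<circ> inv_into W c)"
      by (simp only: Ck_on.simps)
    with continuous_on_subset[OF ch(2) Int_lower2]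
    have "continuous_on (S \<inter> W) ((f \<circ> inv_into W c) \<circ> c)"
      by (rule continuous_on_compose)
    then show ?thesis
      unfolding C fst_conv by (rule continuous_on_eq) (simp add: ch(3))
  qed
  moreover have "open (S \<inter> fst C)" if "C \<in> A" for C
    using chart_properties(1)[OF A, of "fst C" "snd C"] that \<open>open S\<close> by (simp add: open_Int)
  moreover have "(\<Union>C\<in>A. S \<inter> fst C) = S"
    using A by (auto simp: smooth_atlas_def split_beta)
  ultimately show ?thesis
    using continuous_on_open_UN[of A "\<lambda>C. S \<inter> fst C" f] by simp
qed

section \<open>Tangent vectors and vector fields\<close>

lemma smooth_funs_closed:
  assumes A: "smooth_atlas A"
  shows "f \<in> smooth_funs A \<Longrightarrow> g \<in> smooth_funs A \<Longrightarrow> f + g \<in> smooth_funs A"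
    and "f \<in> smooth_funs A \<Longrightarrow> g \<in> smooth_funs A \<Longrightarrow> f * g \<in> smooth_funs A"
    and "f \<in> smooth_funs A \<Longrightarrow> a *\<^sub>R f \<in> smooth_funs A"
  using smooth_fun_on_add[OF A open_UNIV, of f g] smooth_fun_on_mult[OF A open_UNIV, of f g]
    smooth_fun_on_mult[OF A open_UNIV smooth_fun_on_const[OF A open_UNIV, of a], of f]
  by (simp_all add: smooth_funs_def plus_fun_def times_fun_def scaleR_fun_def)

lemma tangent_spaceD:
  assumes "v \<in> tangent_space A p"
  shows "f \<in> smooth_funs A \<Longrightarrow> g \<in> smooth_funs A \<Longrightarrow> v (f + g) = v f + v g"
    and "f \<in> smooth_funs A \<Longrightarrow> v (a *\<^sub>R f) = a * v f"
    and "f \<in> smooth_funs A \<Longrightarrow> g \<in> smooth_funs A \<Longrightarrow> v (f * g) = f p * v g + g p * v f"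
    and "f \<notin> smooth_funs A \<Longrightarrow> v f = 0"
  using assms by (auto simp: tangent_space_def)

lemma subspace_tangent_space: "subspace (tangent_space A p)"
  by (auto simp: subspace_def tangent_space_def scaleR_fun_def algebra_simps)

lemma smooth_vfield_on_add:
  assumes "smooth_atlas A" "open S" "smooth_vfield_on A S X" "smooth_vfield_on A S Y"
  shows "smooth_vfield_on A S (\<lambda>p. X p + Y p)"
  using assms(3,4)
  by (auto simp: smooth_vfield_on_def act_def
      intro!: subspace_add[OF subspace_tangent_space] smooth_fun_on_add[OF assms(1,2)])

lemma smooth_vfield_on_scale:
  assumes "smooth_atlas A" "open S" "smooth_fun_on A S f" "smooth_vfield_on A S X"
  shows "smooth_vfield_on A S (\<lambda>p. f p *\<^sub>R X p)"
  using assms(3,4) subspace_scale[OF subspace_tangent_space]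
  by (fastforce simp: smooth_vfield_on_def act_def scaleR_fun_def
      intro!: smooth_fun_on_mult[OF assms(1,2)])

lemma smooth_vfield_on_zero:
  "smooth_atlas A \<Longrightarrow> open S \<Longrightarrow> smooth_vfield_on A S (\<lambda>_. 0)"
  by (auto simp: smooth_vfield_on_def act_def
      intro!: subspace_0[OF subspace_tangent_space] smooth_fun_on_const)

lemma smooth_vfield_on_sum:
  assumes "smooth_atlas A" "open S" "\<And>i. i \<in> I \<Longrightarrow> smooth_vfield_on A S (X i)"
  shows "smooth_vfield_on A S (\<lambda>p. \<Sum>i\<in>I. X i p)"
  using assms(3)
  by (induction I rule: infinite_finite_induct)
    (simp_all add: smooth_vfield_on_zero[OF assms(1,2)] smooth_vfield_on_add[OF assms(1,2)])

lemma smooth_vfield_on_diff: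
  assumes "smooth_atlas A" "open S" "smooth_vfield_on A S X" "smooth_vfield_on A S Y"
  shows "smooth_vfield_on A S (\<lambda>p. X p - Y p)"
  using assms(3,4)
  by (auto simp: smooth_vfield_on_def act_def
      intro!: subspace_diff[OF subspace_tangent_space] smooth_fun_on_diff[OF assms(1,2)])

lemma smooth_vfield_on_subset:
  "smooth_vfield_on A S X \<Longrightarrow> T \<subseteq> S \<Longrightarrow> smooth_vfield_on A T X"
  by (auto simp: smooth_vfield_on_def intro: smooth_fun_on_subset)

text \<open>Smoothness of a vector field can be checked against local formulas for it, which is how the
  smoothness of projections is obtained from local frames.\<close>

lemma smooth_vfield_on_local:
  assumes "smooth_atlas A"
    and "\<And>p. p \<in> S \<Longrightarrow> \<exists>U Y. open U \<and> p \<in> U \<and> smooth_vfield_on A U Y \<and> (\<forall>q\<in>U. X q = Y q)"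
  shows "smooth_vfield_on A S X"
  unfolding smooth_vfield_on_def
proof (intro conjI ballI)
  fix p assume "p \<in> S"
  then show "X p \<in> tangent_space A p"
    using assms(2)[of p] by (auto simp: smooth_vfield_on_def)
next
  fix f assume f: "f \<in> smooth_funs A"
  show "smooth_fun_on A S (act X f)"
  proof (rule smooth_fun_on_local[OF assms(1)])
    fix p assume "p \<in> S"
    then obtain U Y where U: "open U" "p \<in> U" "smooth_vfield_on A U Y" "\<forall>q\<in>U. X q = Y q"
      using assms(2) by blast
    have "smooth_fun_on A U (act Y f)" using U(3) f by (simp add: smooth_vfield_on_def)
    then have "smooth_fun_on A U (act X f)"
      using U(4) chart_properties(4)[OF assms(1) _ U(1)] chart_properties(3)[OF assms(1)]
      unfolding smooth_fun_on_def smooth_on_def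
      by (fastforce simp: act_def intro: Ck_on_cong[rotated 2])
    then show "\<exists>U. open U \<and> p \<in> U \<and> smooth_fun_on A U (act X f)" using U by blast
  qed
qed

lemma vfields_closed:
  assumes A: "smooth_atlas A"
  shows "X \<in> vfields A \<Longrightarrow> Y \<in> vfields A \<Longrightarrow> X + Y \<in> vfields A"
    and "X \<in> vfields A \<Longrightarrow> Y \<in> vfields A \<Longrightarrow> X - Y \<in> vfields A"
    and "X \<in> vfields A \<Longrightarrow> c *\<^sub>R X \<in> vfields A"
  using smooth_vfield_on_add[OF A open_UNIV, of X Y] smooth_vfield_on_diff[OF A open_UNIV, of X Y]
    smooth_vfield_on_scale[OF A open_UNIV smooth_fun_on_const[OF A open_UNIV, of c], of X]
  by (simp_all add: vfields_def plus_fun_def fun_diff_def scaleR_fun_def[of c X])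

lemma zero_vfield: "smooth_atlas A \<Longrightarrow> 0 \<in> vfields A"
  using smooth_vfield_on_zero[of A UNIV] by (simp add: vfields_def zero_fun_def)

lemma act_smooth: "X \<in> vfields A \<Longrightarrow> f \<in> smooth_funs A \<Longrightarrow> act X f \<in> smooth_funs A"
  by (simp add: vfields_def smooth_vfield_on_def smooth_funs_def)

lemma act_algebra:
  assumes "X \<in> vfields A" "f \<in> smooth_funs A"
  shows "g \<in> smooth_funs A \<Longrightarrow> act X (f + g) = act X f + act X g"
    and "g \<in> smooth_funs A \<Longrightarrow> act X (f * g) = f * act X g + g * act X f"
    and "act X (a *\<^sub>R f) = a *\<^sub>R act X f"
  using assms
  by (auto simp: vfields_def smooth_vfield_on_def act_def tangent_space_def fun_eq_iff scaleR_fun_def)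

text \<open>The second-order terms of \<open>X (Y (f g))\<close> are symmetric in \<open>X\<close> and \<open>Y\<close>, so that the
  commutator is again a derivation.\<close>

lemma lie_bracket_vfield:
  assumes A: "smooth_atlas A" and X: "X \<in> vfields A" and Y: "Y \<in> vfields A"
  shows "lie_bracket A X Y \<in> vfields A"
proof -
  have T: "X p \<in> tangent_space A p" "Y p \<in> tangent_space A p" for p
    using X Y by (auto simp: vfields_def smooth_vfield_on_def)
  note sm = smooth_funs_closed[OF A] act_smooth[OF X] act_smooth[OF Y]
  have "lie_bracket A X Y p \<in> tangent_space A p" for p
    unfolding tangent_space_def lie_bracket_def
    by (auto simp: sm act_algebra[OF X] act_algebra[OF Y] tangent_spaceD[OF T(1)]
        tangent_spaceD[OF T(2)] algebra_simps) (simp_all add: act_def)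
  moreover have "smooth_fun_on A UNIV (act (lie_bracket A X Y) f)" if "f \<in> smooth_funs A" for f
  proof -
    have "act (lie_bracket A X Y) f = (\<lambda>p. act X (act Y f) p - act Y (act X f) p)"
      using that by (simp add: act_def lie_bracket_def)
    then show ?thesis
      using smooth_fun_on_diff[OF A open_UNIV] sm(4,5) that by (simp add: smooth_funs_def)
  qed
  ultimately show ?thesis by (simp add: vfields_def smooth_vfield_on_def)
qed

lemma lie_bracket_antisym: "lie_bracket A X Y = - lie_bracket A Y X"
  by (auto simp: lie_bracket_def fun_eq_iff)

lemma lie_bracket_add_right:
  assumes "X \<in> vfields A" "Y \<in> vfields A" "Z \<in> vfields A"
  shows "lie_bracket A X (Y + Z) = lie_bracket A X Y + lie_bracket A X Z"
proof -
  have T: "X p \<in> tangent_space A p" for p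
    using assms by (auto simp: vfields_def smooth_vfield_on_def)
  have act_add: "act (Y + Z) f = act Y f + act Z f" for f by (auto simp: act_def)
  have "X p (act Y f + act Z f) = X p (act Y f) + X p (act Z f)" if "f \<in> smooth_funs A" for p f
    by (rule tangent_spaceD(1)[OF T act_smooth[OF assms(2) that] act_smooth[OF assms(3) that]])
  then show ?thesis
    by (auto simp: lie_bracket_def fun_eq_iff act_add)
qed

section \<open>Projections onto complementary distributions\<close>

text \<open>One step of Gauss--Jordan elimination on the matrix \<open>e\<^sub>i (f\<^sub>j)\<close>, carried out smoothly in \<open>q\<close>: the pivot
  row \<open>e\<^sub>k\<close> is scaled so that \<open>f\<close> takes the value 1 on it, and multiples of it clear the column of \<open>f\<close>
  in the other rows. The last property says that columns on which the pivot row vanishes, in particular the columns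
  treated before, survive the step.\<close>

lemma smooth_pivot_elimination:
  fixes A :: "('a::topological_space, 'b::euclidean_space) chart set"
  assumes A: "smooth_atlas A" and U: "open U" "p \<in> U" and "k < n"
    and e: "\<And>i. i < n \<Longrightarrow> smooth_vfield_on A U (e i)"
    and f: "e k p f \<noteq> 0"
  obtains U' e' where "open U'" "p \<in> U'" "U' \<subseteq> U"
    "\<And>i. i < n \<Longrightarrow> smooth_vfield_on A U' (e' i)"
    "\<And>q. q \<in> U' \<Longrightarrow> span ((\<lambda>i. e' i q) ` {..<n}) = span ((\<lambda>i. e i q) ` {..<n})"
    "\<And>q i. q \<in> U' \<Longrightarrow> i < n \<Longrightarrow> e' i q f = of_bool (i = k)"
    "\<And>q i g. q \<in> U' \<Longrightarrow> e k q g = 0 \<Longrightarrow> e' i q g = of_bool (i \<noteq> k) * e i q g"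
proof -
  \<comment> \<open>tangent vectors vanish on non-smooth functions, so the pivot entry forces \<open>f\<close> to be smooth\<close>
  have "e k p \<in> tangent_space A p" using e \<open>k < n\<close> U by (simp add: smooth_vfield_on_def)
  then have fs: "f \<in> smooth_funs A" using f tangent_spaceD(4) by blast
  define a where "a i q = e i q f" for i q
  define U' where "U' = {q \<in> U. a k q \<noteq> 0}"
  define e' where "e' i = (\<lambda>q. if i = k then inverse (a k q) *\<^sub>R e k q
    else e i q - (a i q * inverse (a k q)) *\<^sub>R e k q)" for i
  have sa: "smooth_fun_on A U (a i)" if "i < n" for i
    using e[OF that] fs by (simp add: smooth_vfield_on_def act_def a_def [abs_def])
  have U': "open U'"
    using continuous_open_preimage[OF smooth_fun_on_continuous[OF A U(1) sa[OF \<open>k < n\<close>]] U(1)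
        open_Compl[OF closed_singleton[of 0]]]
    by (simp add: U'_def vimage_def Int_def)
  have sub: "U' \<subseteq> U" by (auto simp: U'_def)
  have sa': "smooth_fun_on A U' (a i)" if "i < n" for i
    by (rule smooth_fun_on_subset[OF sa[OF that] sub])
  have inv: "smooth_fun_on A U' (\<lambda>q. inverse (a k q))"
    by (rule smooth_fun_on_inverse[OF A U' _ sa'[OF \<open>k < n\<close>]]) (simp add: U'_def)
  have e_sub: "smooth_vfield_on A U' (e i)" if "i < n" for i
    by (rule smooth_vfield_on_subset[OF e[OF that] sub])
  have e': "smooth_vfield_on A U' (e' i)" if "i < n" for i
  proof (cases "i = k")
    case True
    then show ?thesis
      using smooth_vfield_on_scale[OF A U' inv e_sub[OF \<open>k < n\<close>]] by (simp add: e'_def)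
  next
    case False
    then show ?thesis
      using smooth_vfield_on_diff[OF A U' e_sub[OF that]
          smooth_vfield_on_scale[OF A U' smooth_fun_on_mult[OF A U' sa'[OF that] inv] e_sub[OF \<open>k < n\<close>]]]
      by (simp add: e'_def)
  qed
  have span: "span ((\<lambda>i. e' i q) ` {..<n}) = span ((\<lambda>i. e i q) ` {..<n})" (is "span ?S' = span ?S")
    if "q \<in> U'" for q
  proof
    have "e i q \<in> span ?S" if "i < n" for i using that by (auto intro: span_base)
    then have "e' i q \<in> span ?S" if "i < n" for i
      using that \<open>k < n\<close> by (auto simp: e'_def intro!: span_scale span_diff)
    then show "span ?S' \<subseteq> span ?S" by (intro span_minimal subspace_span) auto
    have e'S: "e' i q \<in> span ?S'" if "i < n" for i using that by (auto intro: span_base)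
    have nz: "a k q \<noteq> 0" using \<open>q \<in> U'\<close> by (simp add: U'_def)
    have "e k q = a k q *\<^sub>R e' k q" using nz by (simp add: e'_def)
    then have k: "e k q \<in> span ?S'" using e'S[OF \<open>k < n\<close>] span_scale by metis
    have "e i q \<in> span ?S'" if "i < n" for i
    proof (cases "i = k")
      case False
      then have "e i q = e' i q + (a i q * inverse (a k q)) *\<^sub>R e k q" by (simp add: e'_def)
      then show ?thesis using span_add[OF e'S[OF that] span_scale[OF k]] by metis
    qed (use k in simp)
    then show "span ?S \<subseteq> span ?S'" by (intro span_minimal subspace_span) auto
  qed
  have new: "e' i q f = of_bool (i = k)" if "q \<in> U'" for i q
    using that by (auto simp: e'_def U'_def scaleR_fun_def a_def)
  have old: "e' i q g = of_bool (i \<noteq> k) * e i q g" if "e k q g = 0" for q i g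
    using that by (auto simp: e'_def scaleR_fun_def)
  have "p \<in> U'" using f U(2) by (simp add: U'_def a_def)
  then show ?thesis by (rule that[OF U' _ sub e' span new old])
qed

text \<open>If \<open>e k\<close> were 0, the other \<open>n - 1\<close> vectors would already span the space. This keeps the
  elimination going without an explicit record of linear independence.\<close>

lemma frame_vectors_nonzero:
  fixes e :: "nat \<Rightarrow> 'v::real_vector"
  assumes "dim (span (e ` {..<n})) = n" "k < n"
  shows "e k \<noteq> 0"
proof
  assume 0: "e k = 0"
  have "e ` {..<n} = insert (e k) (e ` ({..<n} - {k}))" using assms(2) by auto
  then have "span (e ` {..<n}) = span (e ` ({..<n} - {k}))" by (simp only: 0 span_insert_0)
  then have "dim (span (e ` {..<n})) \<le> card (e ` ({..<n} - {k}))"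
    by (metis dim_le_card finite_Diff finite_imageI finite_lessThan order_refl)
  also have "\<dots> \<le> n - 1"
    using card_image_le[of "{..<n} - {k}" e] assms(2) by simp
  finally show False using assms by simp
qed

text \<open>If a family \<open>F\<close> of functions separates the vectors of \<open>P p\<close>, then \<open>P\<close> has a smooth frame near \<open>p\<close>
  that is dual to \<open>n\<close> members of \<open>F\<close>. Elimination never gets stuck: a frame vector at \<open>p\<close> is nonzero,
  so some function in \<open>F\<close> serves as its pivot.\<close>

lemma smooth_frame_with_dual_functions:
  fixes A :: "('a::topological_space, 'b::euclidean_space) chart set"
  assumes A: "smooth_atlas A" and P: "smooth_distribution A n P"
    and sep: "\<forall>u\<in>P p. (\<forall>f\<in>F. u f = 0) \<longrightarrow> u = 0"
  shows "\<exists>U e f. open U \<and> p \<in> U \<and> (\<forall>i<n. smooth_vfield_on A U (e i)) \<and>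
    (\<forall>q\<in>U. span ((\<lambda>i. e i q) ` {..<n}) = P q) \<and> (\<forall>j<n. f j \<in> F) \<and>
    (\<forall>q\<in>U. \<forall>i<n. \<forall>j<n. e i q (f j) = of_bool (i = j))"
proof -
  have "\<exists>U e f. open U \<and> p \<in> U \<and> (\<forall>i<n. smooth_vfield_on A U (e i)) \<and>
      (\<forall>q\<in>U. span ((\<lambda>i. e i q) ` {..<n}) = P q) \<and> (\<forall>j<k. f j \<in> F) \<and>
      (\<forall>q\<in>U. \<forall>i<n. \<forall>j<k. e i q (f j) = of_bool (i = j))" if "k \<le> n" for k
    using that
  proof (induction k)
    case 0
    show ?case using P unfolding smooth_distribution_def by auto metis
  next
    case (Suc k)
    from Suc.IH[OF Suc_leD[OF Suc.prems]]
    obtain U e f where U: "open U" "p \<in> U" and e: "\<And>i. i < n \<Longrightarrow> smooth_vfield_on A U (e i)"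
      and span: "\<And>q. q \<in> U \<Longrightarrow> span ((\<lambda>i. e i q) ` {..<n}) = P q"
      and f: "\<And>j. j < k \<Longrightarrow> f j \<in> F"
      and dual: "\<And>q i j. q \<in> U \<Longrightarrow> i < n \<Longrightarrow> j < k \<Longrightarrow> e i q (f j) = of_bool (i = j)"
      by metis
    have k: "k < n" using Suc.prems by simp
    obtain d where "inj_on (\<lambda>i. d i p) {..<n}" "independent ((\<lambda>i. d i p) ` {..<n})"
      "span ((\<lambda>i. d i p) ` {..<n}) = P p"
      using P unfolding smooth_distribution_def by metis
    then have "dim (P p) = n"
      using dim_span_eq_card_independent[of "(\<lambda>i. d i p) ` {..<n}"] by (simp add: card_image)
    then have "e k p \<noteq> 0"
      using frame_vectors_nonzero[of "\<lambda>i. e i p" n k] span[OF U(2)] k by simp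
    moreover have "e k p \<in> P p" 
      using span_base[of "e k p" "(\<lambda>i. e i p) ` {..<n}"] span[OF U(2)] k by simp
    ultimately obtain g where g: "g \<in> F" "e k p g \<noteq> 0" using sep by metis
    obtain U' e' where U': "open U'" "p \<in> U'" "U' \<subseteq> U"
      and e': "\<And>i. i < n \<Longrightarrow> smooth_vfield_on A U' (e' i)"
      and span': "\<And>q. q \<in> U' \<Longrightarrow> span ((\<lambda>i. e' i q) ` {..<n}) = span ((\<lambda>i. e i q) ` {..<n})"
      and new: "\<And>q i. q \<in> U' \<Longrightarrow> i < n \<Longrightarrow> e' i q g = of_bool (i = k)"
      and old: "\<And>q i g. q \<in> U' \<Longrightarrow> e k q g = 0 \<Longrightarrow> e' i q g = of_bool (i \<noteq> k) * e i q g"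
      by (rule smooth_pivot_elimination[where e = e and f = g, OF A U k e g(2)]) (assumption | rule that)+
    have "e' i q ((f(k := g)) j) = of_bool (i = j)" if "q \<in> U'" "i < n" "j < Suc k" for i q j
    proof (cases "j = k")
      case False
      then have "j < k" "q \<in> U" using that U'(3) by auto
      then show ?thesis
        using old[OF that(1), of "f j" i] dual[of q k j] dual[of q i j] k that(2) by auto
    qed (use new that in simp)
    then show ?case
      using U' e' span' span f g(1)
      by (intro exI[of _ U'] exI[of _ e'] exI[of _ "f(k := g)"]) (auto simp: less_Suc_eq)
  qed
  from this[OF order_refl] show ?thesis .
qed

lemma dual_expansion:
  fixes e :: "nat \<Rightarrow> 'a \<Rightarrow> real"
  assumes "\<And>i j. i < n \<Longrightarrow> j < n \<Longrightarrow> e i (f j) = of_bool (i = j)"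
    and "u \<in> span (e ` {..<n})"
  shows "u = (\<Sum>j<n. u (f j) *\<^sub>R e j)"
  using assms(2)
proof (induction rule: span_induct)
  case base
  have add: "(\<Sum>j<n. (u + v) (f j) *\<^sub>R e j) = (\<Sum>j<n. u (f j) *\<^sub>R e j) + (\<Sum>j<n. v (f j) *\<^sub>R e j)"
    for u v :: "'a \<Rightarrow> real"
    by (simp add: scaleR_left_distrib sum.distrib)
  have scale: "(\<Sum>j<n. (c *\<^sub>R u) (f j) *\<^sub>R e j) = c *\<^sub>R (\<Sum>j<n. u (f j) *\<^sub>R e j)"
    for c and u :: "'a \<Rightarrow> real"
    by (simp add: scaleR_fun_def[of c u] scaleR_sum_right)
  show ?case
  proof (rule subspaceI; unfold mem_Collect_eq)
    show "0 = (\<Sum>j<n. 0 (f j) *\<^sub>R e j)" by simp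
    fix u v :: "'a \<Rightarrow> real" and c :: real
    assume u: "u = (\<Sum>j<n. u (f j) *\<^sub>R e j)"
    show "c *\<^sub>R u = (\<Sum>j<n. (c *\<^sub>R u) (f j) *\<^sub>R e j)"
      by (simp only: scale u[symmetric])
    assume v: "v = (\<Sum>j<n. v (f j) *\<^sub>R e j)"
    show "u + v = (\<Sum>j<n. (u + v) (f j) *\<^sub>R e j)"
      by (simp only: add u[symmetric] v[symmetric])
  qed
next
  case (step u)
  then obtain i where i: "i < n" "u = e i" by auto
  have "(\<Sum>j<n. e i (f j) *\<^sub>R e j) = (\<Sum>j<n. if j = i then e i else 0)"
    using assms(1)[OF i(1)] by (intro sum.cong) auto
  then show ?case using i by simp
qed

lemma component_eqI:
  assumes "subspace (P p)" "subspace (Q p)" "P p \<inter> Q p = {0}" "u \<in> P p" "X p - u \<in> Q p"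
  shows "component P Q X p = u"
  unfolding component_def
proof (rule the_equality)
  fix w assume w: "w \<in> P p \<and> X p - w \<in> Q p"
  then have "w - u \<in> P p" using subspace_diff[OF assms(1)] assms(4) by blast
  moreover have "(X p - u) - (X p - w) \<in> Q p" using subspace_diff[OF assms(2,5)] w by blast
  then have "w - u \<in> Q p" by simp
  ultimately have "w - u \<in> {0}" unfolding assms(3)[symmetric] by (rule IntI)
  then show "w = u" by simp
qed (use assms in simp)

text \<open>Functions in \<open>F\<close> do not see the \<open>Q\<close>-component of a vector, so the coefficients \<open>(pr X) (f\<^sub>j)\<close> of the
  projection in a dual frame are the functions \<open>X (f\<^sub>j)\<close>, which are smooth because \<open>X\<close> is.\<close>

lemma component_smooth:
  fixes A :: "('a::topological_space, 'b::euclidean_space) chart set"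
  assumes A: "smooth_atlas A" and P: "smooth_distribution A n P"
    and Q: "\<And>p. Q p = {v \<in> tangent_space A p. \<forall>f\<in>F. v f = 0}"
    and PT: "\<And>p. P p \<subseteq> tangent_space A p"
    and PQ: "\<And>p. P p \<inter> Q p = {0}" "\<And>p. tangent_space A p = {u + w |u w. u \<in> P p \<and> w \<in> Q p}"
    and sub: "\<And>p. subspace (P p)" "\<And>p. subspace (Q p)"
    and X: "X \<in> vfields A"
  shows "component P Q X \<in> vfields A"
proof -
  have "\<exists>U Y. open U \<and> p \<in> U \<and> smooth_vfield_on A U Y \<and> (\<forall>q\<in>U. component P Q X q = Y q)" for p
  proof -
    have sep: "\<forall>u\<in>P p. (\<forall>f\<in>F. u f = 0) \<longrightarrow> u = 0"
    proof clarify
      fix u assume "u \<in> P p" "\<forall>f\<in>F. u f = 0"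
      then have "u \<in> P p \<inter> Q p" using PT[of p] Q[of p] by auto
      then show "u = 0" using PQ(1)[of p] by simp
    qed
    obtain U e f where U: "open U" "p \<in> U" and e: "\<And>i. i < n \<Longrightarrow> smooth_vfield_on A U (e i)"
      and span: "\<And>q. q \<in> U \<Longrightarrow> span ((\<lambda>i. e i q) ` {..<n}) = P q"
      and f: "\<And>j. j < n \<Longrightarrow> f j \<in> F"
      and dual: "\<And>q i j. q \<in> U \<Longrightarrow> i < n \<Longrightarrow> j < n \<Longrightarrow> e i q (f j) = of_bool (i = j)"
      using smooth_frame_with_dual_functions[OF A P sep] by metis
    \<comment> \<open>nonzero values of tangent vectors are taken on smooth functions only\<close>
    have eT: "f j \<in> smooth_funs A" if "j < n" for j
    proof -
      have "e j p \<in> tangent_space A p" using e[OF that] U(2) by (simp add: smooth_vfield_on_def)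
      moreover have "e j p (f j) \<noteq> 0" using dual[OF U(2) that that] by simp
      ultimately show ?thesis using tangent_spaceD(4) by blast
    qed
    have "smooth_fun_on A U (\<lambda>q. X q (f j))" if "j < n" for j
      using act_smooth[OF X eT[OF that]] smooth_fun_on_subset[of A UNIV _ U]
      by (simp add: smooth_funs_def act_def)
    then have "smooth_vfield_on A U (\<lambda>q. \<Sum>j<n. X q (f j) *\<^sub>R e j q)"
      using e by (intro smooth_vfield_on_sum[OF A U(1)] smooth_vfield_on_scale[OF A U(1)]) auto
    moreover have "component P Q X q = (\<Sum>j<n. X q (f j) *\<^sub>R e j q)" if "q \<in> U" for q
    proof -
      have "X q \<in> tangent_space A q" using X by (simp add: vfields_def smooth_vfield_on_def)
      then obtain u w where uw: "X q = u + w" "u \<in> P q" "w \<in> Q q" using PQ(2)[of q] by auto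
      then have "component P Q X q = u" by (intro component_eqI sub PQ(1)) auto
      also have "u = (\<Sum>j<n. u (f j) *\<^sub>R e j q)"
        using dual_expansion[of n "\<lambda>i. e i q" f u] dual[OF that] span[OF that] uw(2) by simp
      also have "\<dots> = (\<Sum>j<n. X q (f j) *\<^sub>R e j q)"
        using uw(1,3) f Q[of q] by (intro sum.cong) auto
      finally show ?thesis .
    qed
    ultimately show ?thesis using U by blast
  qed
  then show ?thesis
    unfolding vfields_def using smooth_vfield_on_local[OF A, of UNIV "component P Q X"] by simp
qed

text \<open>Smoothness is required of one projection only, but the other one is its complement and so smooth
  as well. The axioms are therefore symmetric in \<open>P\<close> and \<open>Q\<close> (\<open>swap\<close> below), and everything
  proved for the first summand also holds for the second.\<close>

locale smooth_splitting =
  fixes A :: "('a::topological_space, 'b::euclidean_space) chart set"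
    and P Q :: "'a distribution"
  assumes atlas: "smooth_atlas A"
    and P_subspace: "subspace (P p)" and Q_subspace: "subspace (Q p)"
    and P_Q_disjoint: "P p \<inter> Q p = {0}"
    and P_Q_span: "tangent_space A p = {u + w |u w. u \<in> P p \<and> w \<in> Q p}"
    and component_vfield: "X \<in> vfields A \<Longrightarrow> component P Q X \<in> vfields A"
begin

abbreviation pr :: "'a vfield \<Rightarrow> 'a vfield" where "pr \<equiv> component P Q"

abbreviation co :: "'a vfield \<Rightarrow> 'a vfield" where "co \<equiv> component Q P"

lemma sections_vfields: "X \<in> sections A P \<Longrightarrow> X \<in> vfields A"
  by (simp add: sections_def)

lemma pr_eqI: "u \<in> P p \<Longrightarrow> X p - u \<in> Q p \<Longrightarrow> pr X p = u"
  by (rule component_eqI[OF P_subspace Q_subspace P_Q_disjoint])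

lemma pr_mem:
  assumes "X \<in> vfields A"
  shows "pr X p \<in> P p" "X p - pr X p \<in> Q p"
proof -
  have "X p \<in> tangent_space A p" using assms by (simp add: vfields_def smooth_vfield_on_def)
  then obtain u w where uw: "X p = u + w" "u \<in> P p" "w \<in> Q p" using P_Q_span[of p] by auto
  then have "pr X p = u" by (intro pr_eqI) simp_all
  then show "pr X p \<in> P p" "X p - pr X p \<in> Q p" using uw by simp_all
qed

lemma pr_sections: "X \<in> vfields A \<Longrightarrow> pr X \<in> sections A P"
  by (simp add: sections_def component_vfield pr_mem)

lemma pr_id: "X \<in> sections A P \<Longrightarrow> pr X = X"
  by (rule ext, rule pr_eqI) (simp_all add: sections_def subspace_0[OF Q_subspace])

lemma pr_Q: "X \<in> sections A Q \<Longrightarrow> pr X = 0"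
  by (rule ext, rule pr_eqI) (simp_all add: sections_def subspace_0[OF P_subspace])

lemma pr_add:
  assumes "X \<in> vfields A" "Y \<in> vfields A"
  shows "pr (X + Y) = pr X + pr Y"
proof (rule ext, rule pr_eqI)
  fix p
  show "(pr X + pr Y) p \<in> P p"
    using subspace_add[OF P_subspace pr_mem(1)[OF assms(1)] pr_mem(1)[OF assms(2)]] by simp
  have "(X + Y) p - (pr X + pr Y) p = (X p - pr X p) + (Y p - pr Y p)" by simp
  then show "(X + Y) p - (pr X + pr Y) p \<in> Q p"
    using subspace_add[OF Q_subspace pr_mem(2)[OF assms(1)] pr_mem(2)[OF assms(2)]] by metis
qed

lemma co_eq:
  assumes "X \<in> vfields A"
  shows "co X = X - pr X"
proof (rule ext, rule component_eqI[OF Q_subspace P_subspace])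
  fix p
  show "Q p \<inter> P p = {0}" using P_Q_disjoint[of p] by (simp add: Int_commute)
  show "(X - pr X) p \<in> Q p" using pr_mem(2)[OF assms] by simp
  show "X p - (X - pr X) p \<in> P p" using pr_mem(1)[OF assms] by simp
qed

lemma co_sections: "X \<in> vfields A \<Longrightarrow> co X \<in> sections A Q"
  using pr_mem(2) vfields_closed(2)[OF atlas _ component_vfield] by (simp add: co_eq sections_def)

lemma swap: "smooth_splitting A Q P"
proof
  show "tangent_space A p = {u + w |u w. u \<in> Q p \<and> w \<in> P p}" for p
    unfolding P_Q_span[of p] using add.commute by fast
  show "co X \<in> vfields A" if "X \<in> vfields A" for X
    using co_sections[OF that] by (simp add: sections_def)
  show "Q p \<inter> P p = {0}" for p using P_Q_disjoint[of p] by (simp add: Int_commute)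
qed (fact atlas P_subspace Q_subspace)+

lemma zero_section: "0 \<in> sections A P"
  by (simp add: sections_def zero_vfield[OF atlas] subspace_0[OF P_subspace])

lemma diff_section: "X \<in> sections A P \<Longrightarrow> Y \<in> sections A P \<Longrightarrow> X - Y \<in> sections A P"
  by (simp add: sections_def vfields_closed(2)[OF atlas] subspace_diff[OF P_subspace])

lemma add_section: "X \<in> sections A P \<Longrightarrow> Y \<in> sections A P \<Longrightarrow> X + Y \<in> sections A P"
  by (simp add: sections_def vfields_closed(1)[OF atlas] subspace_add[OF P_subspace])

lemma scale_section: "X \<in> sections A P \<Longrightarrow> c *\<^sub>R X \<in> sections A P"
  using vfields_closed(3)[OF atlas, of X c] subspace_scale[OF P_subspace, of _ _ c]
  by (simp add: sections_def scaleR_fun_def [of c X])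

end

section \<open>Paracontact structures on a subbundle\<close>

lemma scaleR_fscale: "c *\<^sub>R X = (\<lambda>_. c) \<odot> X"
  by (simp add: fscale_def scaleR_fun_def)

lemma one_form_linear:
  assumes A: "smooth_atlas A" and \<omega>: "one_form A \<omega>"
  shows "X \<in> vfields A \<Longrightarrow> Y \<in> vfields A \<Longrightarrow> \<omega> (X + Y) = \<omega> X + \<omega> Y"
    and "X \<in> vfields A \<Longrightarrow> Y \<in> vfields A \<Longrightarrow> \<omega> (X - Y) = \<omega> X - \<omega> Y"
    and "\<omega> 0 = 0"
    and "X \<in> vfields A \<Longrightarrow> \<omega> (c *\<^sub>R X) = c *\<^sub>R \<omega> X"
    and "f \<in> smooth_funs A \<Longrightarrow> X \<in> vfields A \<Longrightarrow> \<omega> (f \<odot> X) = f * \<omega> X"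
proof -
  have add: "\<omega> (U + V) = \<omega> U + \<omega> V" if "U \<in> vfields A" "V \<in> vfields A" for U V
    using \<omega> that by (simp add: one_form_def)
  show "\<omega> 0 = 0" using add[OF zero_vfield[OF A] zero_vfield[OF A]] by simp
  show scale: "\<omega> (f \<odot> X) = f * \<omega> X" if "f \<in> smooth_funs A" "X \<in> vfields A" for f X
    using \<omega> that by (simp add: one_form_def)
  assume X: "X \<in> vfields A"
  have "(\<lambda>_. c) \<in> smooth_funs A"
    using smooth_fun_on_const[OF A open_UNIV] by (simp add: smooth_funs_def)
  then show "\<omega> (c *\<^sub>R X) = c *\<^sub>R \<omega> X"
    unfolding scaleR_fscale using scale[OF _ X] by (simp add: times_fun_def scaleR_fun_def)
  assume Y: "Y \<in> vfields A"
  show "\<omega> (X + Y) = \<omega> X + \<omega> Y" by (rule add[OF X Y])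
  show "\<omega> (X - Y) = \<omega> X - \<omega> Y"
    using add[OF vfields_closed(2)[OF A X Y] Y] by simp
qed

text \<open>The conditions that a paracontact metric Finsler structure and a Finsler connection impose
  on one of the two subbundles. \<open>Z\<close> is the component of \<open>\<xi>\<close> in \<open>P\<close>. The conditions on \<open>\<phi>\<close>, \<open>\<eta>\<close> and the torsion
  are stated on sections of \<open>P\<close>, where the part of \<open>\<phi>\<^sup>2\<close> that belongs to \<open>Q\<close> drops out.\<close>

locale paracontact_subbundle = smooth_splitting A P Q
  for A :: "('a::topological_space, 'b::euclidean_space) chart set" and P Q +
  fixes \<phi> :: "'a vfield \<Rightarrow> 'a vfield" and \<eta> :: "'a vfield \<Rightarrow> 'a \<Rightarrow> real" and Z :: "'a vfield"
    and G :: "'a vfield \<Rightarrow> 'a vfield \<Rightarrow> 'a \<Rightarrow> real" and D :: "'a vfield \<Rightarrow> 'a vfield \<Rightarrow> 'a vfield"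
  assumes \<phi>: "tensor11 A \<phi>" and \<eta>: "one_form A \<eta>" and Z: "Z \<in> sections A P" and G: "tensor02 A G"
    and \<eta>_Z: "\<eta> Z = 1"
    and \<phi>_section: "X \<in> sections A P \<Longrightarrow> \<phi> X \<in> sections A P"
    and \<phi>_\<phi>: "X \<in> sections A P \<Longrightarrow> \<phi> (\<phi> X) = X - \<eta> X \<odot> Z"
    and G_sym: "X \<in> vfields A \<Longrightarrow> Y \<in> vfields A \<Longrightarrow> G X Y = G Y X"
    and G_nondegenerate: "nondegenerate_on A P (\<lambda>X Y. G (pr X) (pr Y))"
    and G_\<phi>: "X \<in> sections A P \<Longrightarrow> Y \<in> sections A P \<Longrightarrow> G (\<phi> X) (\<phi> Y) = - G X Y + \<eta> X * \<eta> Y"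
    and d_\<eta>: "X \<in> sections A P \<Longrightarrow> Y \<in> sections A P \<Longrightarrow>
      ext_deriv A (\<lambda>W. \<eta> (pr W)) X Y = G X (\<phi> Y)"
    and D: "linear_connection A D"
    and D_metrical: "X \<in> vfields A \<Longrightarrow> Y \<in> vfields A \<Longrightarrow> W \<in> vfields A \<Longrightarrow> cov_deriv02 D X G Y W = 0"
    and D_pr: "X \<in> vfields A \<Longrightarrow> Y \<in> vfields A \<Longrightarrow> pr (D X Y) = D X (pr Y)"
    and D_symmetric: "X \<in> sections A P \<Longrightarrow> Y \<in> sections A P \<Longrightarrow>
      pr (lie_bracket A X Y) = D X Y - D Y X"
begin

lemmas Z_vfield = sections_vfields[OF Z]

lemmas G_linear =
  one_form_linear[OF atlas conjunct1[OF bspec[OF G[unfolded tensor02_def]]]]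
  one_form_linear[OF atlas conjunct2[OF bspec[OF G[unfolded tensor02_def]]]]

lemma D_vfield: "X \<in> vfields A \<Longrightarrow> Y \<in> vfields A \<Longrightarrow> D X Y \<in> vfields A"
  using D by (simp add: linear_connection_def)

lemma D_section: "X \<in> vfields A \<Longrightarrow> Y \<in> sections A P \<Longrightarrow> D X Y \<in> sections A P"
  using D_pr[of X Y] pr_sections[of "D X Y"] D_vfield[of X Y] by (simp add: pr_id sections_vfields)

lemma D_zero: "Y \<in> vfields A \<Longrightarrow> D 0 Y = 0"
  using D zero_vfield[OF atlas] unfolding linear_connection_def by (metis add_cancel_right_left)

lemma act_G:
  assumes "X \<in> vfields A" "Y \<in> vfields A" "W \<in> vfields A"
  shows "act X (G Y W) = G (D X Y) W + G Y (D X W)"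
  using D_metrical[OF assms] by (simp add: cov_deriv02_def algebra_simps)

text \<open>Applying \<open>\<phi>\<^sup>2 = I - \<eta> \<otimes> Z\<close> to \<open>Z\<close> gives \<open>\<phi>\<^sup>2 Z = 0\<close>, and applying it to \<open>\<phi> Z\<close> gives \<open>\<phi> Z = a Z\<close>.
  Hence \<open>a\<^sup>2 Z = \<phi>\<^sup>2 Z = 0\<close>, and \<open>a = 0\<close> since \<open>\<eta> Z = 1\<close>.\<close>

lemma \<phi>_Z: "\<phi> Z = 0"
proof -
  have add: "\<phi> (X + Y) = \<phi> X + \<phi> Y" if "X \<in> vfields A" "Y \<in> vfields A" for X Y
    using \<phi> that by (simp add: tensor11_def)
  have \<phi>0: "\<phi> 0 = 0" using add[OF zero_vfield[OF atlas] zero_vfield[OF atlas]] by simp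
  have one: "1 \<odot> X = X" for X :: "'a vfield" by (simp add: fscale_def)
  have \<phi>\<phi>Z: "\<phi> (\<phi> Z) = 0" using \<phi>_\<phi>[OF Z] by (simp add: \<eta>_Z one)
  define a where "a = \<eta> (\<phi> Z)"
  have \<phi>Z: "\<phi> Z = a \<odot> Z" using \<phi>_\<phi>[OF \<phi>_section[OF Z]] by (simp add: \<phi>\<phi>Z \<phi>0 a_def)
  have a: "a \<in> smooth_funs A"
    unfolding a_def using \<eta> sections_vfields[OF \<phi>_section[OF Z]] by (simp add: one_form_def)
  have "\<phi> (a \<odot> Z) = a \<odot> \<phi> Z" using \<phi> a Z_vfield by (simp add: tensor11_def)
  then have "a \<odot> \<phi> Z = 0" using \<phi>\<phi>Z \<phi>Z by simp
  then have "\<eta> (a \<odot> \<phi> Z) = 0" using one_form_linear(3)[OF atlas \<eta>] by simp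
  then have "a * a = 0"
    using one_form_linear(5)[OF atlas \<eta> a sections_vfields[OF \<phi>_section[OF Z]]]
    by (simp add: a_def)
  then have "a = 0" by (auto simp: fun_eq_iff)
  then show ?thesis by (simp add: \<phi>Z fscale_def fun_eq_iff scaleR_fun_def)
qed

text \<open>Compatibility of \<open>G\<close> and \<open>\<phi>\<close>, evaluated on the pair \<open>(X, Z)\<close> where \<open>\<phi> Z = 0\<close>.\<close>

lemma \<eta>_eq_G:
  assumes X: "X \<in> sections A P"
  shows "\<eta> X = G X Z"
proof -
  have "G (\<phi> X) 0 = 0"
    using G_linear(3)[OF sections_vfields[OF \<phi>_section[OF X]]] by simp
  then show ?thesis using G_\<phi>[OF X Z] by (simp add: \<phi>_Z \<eta>_Z)
qed

text \<open>On sections of \<open>P\<close> the fundamental form is an exterior derivative, and those are skew by construction.\<close>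

lemma \<Phi>_skew:
  assumes X: "X \<in> sections A P" and Y: "Y \<in> sections A P"
  shows "G X (\<phi> Y) = - G Y (\<phi> X)"
proof -
  have XY: "lie_bracket A X Y \<in> vfields A" "lie_bracket A Y X \<in> vfields A"
    using lie_bracket_vfield[OF atlas] X Y by (simp_all add: sections_vfields)
  have "\<eta> (pr (lie_bracket A X Y)) + \<eta> (pr (lie_bracket A Y X)) = 0"
  proof -
    have "pr (lie_bracket A X Y) + pr (lie_bracket A Y X) = 0"
      using pr_add[OF XY] lie_bracket_antisym[of A X Y] pr_id[OF zero_section] by simp
    then show ?thesis
      using one_form_linear(1)[OF atlas \<eta> component_vfield[OF XY(1)] component_vfield[OF XY(2)]]
        one_form_linear(3)[OF atlas \<eta>] by simp
  qed
  then have "G X (\<phi> Y) + G Y (\<phi> X) = 0"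
    unfolding d_\<eta>[OF X Y, symmetric] d_\<eta>[OF Y X, symmetric] ext_deriv_def
    by (simp add: algebra_simps)
  then show ?thesis by (simp only: eq_neg_iff_add_eq_0)
qed

text \<open>Expand \<open>d\<eta>(X, Y)\<close> with \<open>\<eta> = G(\<cdot>, Z)\<close>: by metricity, the derivatives of \<open>G(Y, Z)\<close> and \<open>G(X, Z)\<close> produce
  \<open>G(D\<^sub>X Y - D\<^sub>Y X, Z)\<close>, which the bracket term cancels by symmetry of \<open>D\<close>.\<close>

lemma \<Phi>_eq_D:
  assumes X: "X \<in> sections A P" and Y: "Y \<in> sections A P"
  shows "G X (\<phi> Y) = G Y (D X Z) - G X (D Y Z)"
proof -
  note v = sections_vfields[OF X] sections_vfields[OF Y] Z_vfield
  have "G X (\<phi> Y) = act X (G Y Z) - act Y (G X Z) - G (D X Y - D Y X) Z"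
    using d_\<eta>[OF X Y] X Y D_section v D_symmetric[OF X Y]
    by (simp add: ext_deriv_def pr_id \<eta>_eq_G diff_section)
  also have "\<dots> = G Y (D X Z) - G X (D Y Z)"
    using G_linear(7)[OF v(3) D_vfield[OF v(1,2)] D_vfield[OF v(2,1)]]
    by (simp add: act_G v)
  finally show ?thesis .
qed

text \<open>Symmetry of \<open>D\<close> expresses \<open>pr [Z, W]\<close> through \<open>D\<close> only for sections \<open>W\<close> of \<open>P\<close>; the brackets of \<open>Z\<close> with the
  \<open>Q\<close>-components remain. The terms containing \<open>D\<^sub>Z\<close> cancel by metricity.\<close>

lemma lie_deriv_G:
  assumes X: "X \<in> vfields A" and Y: "Y \<in> vfields A"
  shows "lie_deriv02 A Z (\<lambda>X Y. G (pr X) (pr Y)) X Y =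
    G (D (pr X) Z) (pr Y) + G (pr X) (D (pr Y) Z)
    - G (pr (lie_bracket A Z (co X))) (pr Y) - G (pr X) (pr (lie_bracket A Z (co Y)))"
proof -
  have split: "pr (lie_bracket A Z W) = D Z (pr W) - D (pr W) Z + pr (lie_bracket A Z (co W))"
    if W: "W \<in> vfields A" for W
  proof -
    have v: "pr W \<in> vfields A" "co W \<in> vfields A"
      using component_vfield[OF W] co_sections[OF W] by (simp_all add: sections_def)
    have "W = pr W + co W" using co_eq[OF W] by simp
    then have "lie_bracket A Z W = lie_bracket A Z (pr W) + lie_bracket A Z (co W)"
      using lie_bracket_add_right[OF Z_vfield v] by metis
    then show ?thesis
      using pr_add lie_bracket_vfield[OF atlas Z_vfield] v D_symmetric[OF Z pr_sections[OF W]] by simp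
  qed
  have v: "pr X \<in> vfields A" "pr Y \<in> vfields A" "co X \<in> vfields A" "co Y \<in> vfields A"
    using component_vfield X Y co_sections by (simp_all add: sections_def)
  have u: "D Z (pr X) \<in> vfields A" "D (pr X) Z \<in> vfields A" "pr (lie_bracket A Z (co X)) \<in> vfields A"
    "D Z (pr Y) \<in> vfields A" "D (pr Y) Z \<in> vfields A" "pr (lie_bracket A Z (co Y)) \<in> vfields A"
    using v Z_vfield by (simp_all add: D_vfield component_vfield lie_bracket_vfield[OF atlas])
  show ?thesis
    unfolding lie_deriv02_def split[OF X] split[OF Y]
    by (simp add: act_G Z_vfield v u G_linear vfields_closed[OF atlas] algebra_simps)
qed

text \<open>On \<open>P \<times> P\<close> the Killing equation makes \<open>X \<mapsto> D\<^sub>X Z\<close> skew, and then \<open>\<Phi>_eq_D\<close> reads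
  \<open>2 G(D\<^sub>X Z, Y) = -G(\<phi> X, Y)\<close>; non-degeneracy of \<open>G\<close> on \<open>P\<close> removes \<open>Y\<close>. Conversely, \<open>-\<phi>/2\<close> is skew by
  \<open>\<Phi>_skew\<close>, so that the two conditions annihilate all terms of \<open>lie_deriv_G\<close>.\<close>

lemma Killing_iff:
  "Killing A Z (\<lambda>X Y. G (pr X) (pr Y)) \<longleftrightarrow>
    (\<forall>X\<in>sections A P. D X Z = - (1/2) *\<^sub>R \<phi> X) \<and>
    (\<forall>X\<in>sections A Q. \<forall>Y\<in>sections A P. G (pr (lie_bracket A Z X)) Y = 0)"
  (is "?K \<longleftrightarrow> ?D \<and> ?B")
proof (intro iffI conjI)
  have Q: "X \<in> vfields A" if "X \<in> sections A Q" for X using that by (simp add: sections_def)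
  have G0: "G 0 X = 0" "G X 0 = 0" if "X \<in> vfields A" for X
    using G_linear(3,8)[OF that] by auto
  have lie0: "lie_bracket A Z 0 = 0"
    using lie_bracket_add_right[OF Z_vfield zero_vfield[OF atlas] zero_vfield[OF atlas]] by simp
  have co0: "co X = 0" if "X \<in> sections A P" for X
    using co_eq[OF sections_vfields[OF that]] pr_id[OF that] by simp
  have co_id: "co X = X" if "X \<in> sections A Q" for X
    using co_eq[OF Q[OF that]] pr_Q[OF that] by simp
  note pr0 = pr_id[OF zero_section]
  {
    assume K: ?K
    show ?D
    proof
      fix X assume X: "X \<in> sections A P"
      note vX = sections_vfields[OF X]
      have DX: "D X Z \<in> vfields A" and \<phi>X: "\<phi> X \<in> vfields A"
        using D_vfield[OF vX Z_vfield] sections_vfields[OF \<phi>_section[OF X]] by auto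
      define W where "W = D X Z + (1/2) *\<^sub>R \<phi> X"
      have W: "W \<in> sections A P"
        unfolding W_def by (intro add_section scale_section D_section vX Z \<phi>_section X)
      have "G (pr W) (pr Y) = 0" if Y: "Y \<in> sections A P" for Y
      proof -
        note vY = sections_vfields[OF Y]
        have "lie_deriv02 A Z (\<lambda>X Y. G (pr X) (pr Y)) X Y = 0"
          using K vX vY by (simp add: Killing_def)
        then have skew: "G (D X Z) Y + G X (D Y Z) = 0"
          using lie_deriv_G[OF vX vY]
          by (simp add: pr_id[OF X] pr_id[OF Y] co0[OF X] co0[OF Y] lie0 pr0 G0 vX vY)
        have contact: "- G Y (\<phi> X) = G Y (D X Z) - G X (D Y Z)"
          using \<Phi>_eq_D[OF X Y] \<Phi>_skew[OF X Y] by simp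
        have W_Y: "G W Y = G (D X Z) Y + (1/2) *\<^sub>R G (\<phi> X) Y"
          unfolding W_def
          by (simp add: G_linear(6,9)[OF vY] DX \<phi>X vfields_closed(3)[OF atlas] Z_vfield)
        have "G W Y q = 0" for q
          using fun_cong[OF skew, of q] fun_cong[OF contact, of q] fun_cong[OF W_Y, of q]
          by (simp add: G_sym[OF \<phi>X vY] G_sym[OF DX vY] scaleR_fun_def)
        then show ?thesis by (simp add: pr_id[OF W] pr_id[OF Y] fun_eq_iff)
      qed
      then have "W p = 0" for p
        using G_nondegenerate W unfolding nondegenerate_on_def by (metis zero_fun_apply)
      then have "W = 0" by (simp add: fun_eq_iff)
      then show "D X Z = - (1/2) *\<^sub>R \<phi> X" unfolding W_def by (simp add: add_eq_0_iff2)
    qed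
    show ?B
    proof (intro ballI)
      fix X Y assume X: "X \<in> sections A Q" and Y: "Y \<in> sections A P"
      note v = Q[OF X] sections_vfields[OF Y]
      have "lie_deriv02 A Z (\<lambda>X Y. G (pr X) (pr Y)) X Y = 0"
        using K v by (simp add: Killing_def)
      then show "G (pr (lie_bracket A Z X)) Y = 0"
        using lie_deriv_G[OF v]
        by (simp add: pr_Q[OF X] pr_id[OF Y] co_id[OF X] co0[OF Y] lie0 pr0 G0 v D_zero
            D_vfield Z_vfield zero_vfield[OF atlas])
    qed
  }
  assume "?D \<and> ?B"
  then have D: "\<And>X. X \<in> sections A P \<Longrightarrow> D X Z = - (1/2) *\<^sub>R \<phi> X"
    and B: "\<And>X Y. X \<in> sections A Q \<Longrightarrow> Y \<in> sections A P \<Longrightarrow> G (pr (lie_bracket A Z X)) Y = 0"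
    by blast+
  show ?K
    unfolding Killing_def
  proof (intro ballI)
    fix X Y assume X: "X \<in> vfields A" and Y: "Y \<in> vfields A"
    note s = pr_sections[OF X] pr_sections[OF Y]
    note v = s[THEN sections_vfields] s[THEN \<phi>_section, THEN sections_vfields]
    have l: "pr (lie_bracket A Z (co Y)) \<in> vfields A"
      using Q[OF co_sections[OF Y]] by (intro component_vfield lie_bracket_vfield[OF atlas Z_vfield])
    have "G (pr X) (pr (lie_bracket A Z (co Y))) = 0"
      using B[OF co_sections[OF Y] s(1)] G_sym[OF v(1) l] by simp
    moreover have "G (D (pr X) Z) (pr Y) + G (pr X) (D (pr Y) Z)
        = - (1/2) *\<^sub>R (G (pr Y) (\<phi> (pr X)) + G (pr X) (\<phi> (pr Y)))"
      using G_linear(9)[OF v(2,3), of "- (1/2)"] G_linear(4)[OF v(1,4), of "- (1/2)"]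
        G_sym[OF v(3,2)]
      by (simp add: D s scaleR_right_distrib)
    ultimately show "lie_deriv02 A Z (\<lambda>X Y. G (pr X) (pr Y)) X Y = 0"
      using lie_deriv_G[OF X Y] B[OF co_sections[OF X] s(2)] \<Phi>_skew[OF s(2,1)] by simp
  qed
qed

end

section \<open>The splitting of a vector bundle by a nonlinear connection\<close>

text \<open>By definition of the pushforward, the functions \<open>f \<circ> \<pi>\<close> with \<open>f\<close> smooth on the base cut out the
  vertical bundle, which is the hypothesis of \<open>component_smooth\<close>.\<close>

lemma nonlinear_connection_splitting:
  fixes B :: "('e::topological_space, 'm::topological_space, 'b::euclidean_space, 'f::euclidean_space) vbundle"
  assumes B: "smooth_vector_bundle B" and H: "nonlinear_connection B H"
  shows "smooth_splitting (total_atlas B) H (vertical B)"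
proof
  let ?A = "total_atlas B"
  define F where "F = {f \<circ> bproj B |f. f \<in> smooth_funs (base_atlas B)}"
  show atlas: "smooth_atlas ?A" using B by (simp add: smooth_vector_bundle_def)
  note dist = conjunct1[OF H[unfolded nonlinear_connection_def]]
  note decomp = spec[OF conjunct2[OF H[unfolded nonlinear_connection_def]]]
  note HT = conjunct1[OF decomp]
    and disj = conjunct1[OF conjunct2[OF decomp]]
    and sum = conjunct2[OF conjunct2[OF decomp]]
  have V: "vertical B p = {v \<in> tangent_space ?A p. \<forall>f\<in>F. v f = 0}" for p
  proof -
    have "pushforward (base_atlas B) (bproj B) v = 0 \<longleftrightarrow> (\<forall>f\<in>F. v f = 0)" for v
      unfolding pushforward_def F_def fun_eq_iff[of _ 0] by auto
    then show ?thesis by (simp add: vertical_def)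
  qed
  show HS: "subspace (H p)" for p
    using dist subspace_span unfolding smooth_distribution_def by metis
  have "subspace {v :: 'e tangent. \<forall>f\<in>F. v f = 0}"
    by (simp add: subspace_def scaleR_fun_def)
  then show VS: "subspace (vertical B p)" for p
    unfolding V Collect_conj_eq by (simp add: subspace_inter subspace_tangent_space)
  show "H p \<inter> vertical B p = {0}" for p by (rule disj)
  show "tangent_space ?A p = {u + w |u w. u \<in> H p \<and> w \<in> vertical B p}" for p by (rule sum)
  show "component H (vertical B) X \<in> vfields ?A" if "X \<in> vfields ?A" for X
    by (rule component_smooth[OF atlas dist V HT disj sum HS VS that])
qed

theorem theorem4p7:
  fixes B :: "('e::{t2_space, second_countable_topology}, 'm::{t2_space, second_countable_topology},
               'b::euclidean_space, 'f::euclidean_space) vbundle"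
    and H :: "'e distribution"
    and \<phi> :: "'e vfield \<Rightarrow> 'e vfield"
    and \<eta> :: "'e vfield \<Rightarrow> 'e \<Rightarrow> real"
    and \<xi> :: "'e vfield"
    and G :: "'e vfield \<Rightarrow> 'e vfield \<Rightarrow> 'e \<Rightarrow> real"
    and D :: "'e vfield \<Rightarrow> 'e vfield \<Rightarrow> 'e vfield"
  assumes "smooth_vector_bundle B"
    and "nonlinear_connection B H"
    and "paracontact_metric_Finsler B H \<phi> \<eta> \<xi> G"
    and "Finsler_connection B H G D"
  shows "K_paracontact_Finsler B H \<phi> \<eta> \<xi> G \<longleftrightarrow>
    (\<forall>X\<in>tvfields B. \<forall>Y\<in>tvfields B.
       D (hor B H X) (hor B H \<xi>) = - (1/2) *\<^sub>R \<phi> (hor B H X) \<and>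
       GH B H G (hor B H (tbracket B (hor B H \<xi>) (ver B H X))) (hor B H Y) = 0 \<and>
       D (ver B H X) (ver B H \<xi>) = - (1/2) *\<^sub>R \<phi> (ver B H X) \<and>
       GV B H G (ver B H (tbracket B (ver B H \<xi>) (hor B H X))) (ver B H Y) = 0)"
proof -
  let ?A = "total_atlas B" and ?V = "vertical B"
  interpret h: smooth_splitting ?A H ?V
    by (rule nonlinear_connection_splitting[OF assms(1,2)])
  interpret v: smooth_splitting ?A ?V H
    by (rule h.swap)
  note defs = hor_def[of B H] ver_def[of B H] GH_def GV_def
  note [simp] = h.pr_sections v.pr_sections h.sections_vfields v.sections_vfields
    h.pr_id v.pr_id h.pr_Q v.pr_Q h.component_vfield v.component_vfield
  have metric: "almost_paracontact_metric_Finsler B H \<phi> \<eta> \<xi> G"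
    and d_eta: "\<And>X Y. X \<in> tvfields B \<Longrightarrow> Y \<in> tvfields B \<Longrightarrow>
      ext_deriv ?A (\<lambda>Z. \<eta> (h.pr Z)) X Y = G (h.pr X) (\<phi> (h.pr Y)) \<and>
      ext_deriv ?A (\<lambda>Z. \<eta> (v.pr Z)) X Y = G (v.pr X) (\<phi> (v.pr Y))"
    using assms(3) by (auto simp: paracontact_metric_Finsler_def fundamental_form_def defs)
  have apf: "almost_paracontact_Finsler B H \<phi> \<eta> \<xi>" and pm: "pseudo_metric_structure B H G"
    and G_phi: "\<And>X Y. X \<in> tvfields B \<Longrightarrow> Y \<in> tvfields B \<Longrightarrow>
      G (h.pr (\<phi> X)) (h.pr (\<phi> Y)) = - G (h.pr X) (h.pr Y) + \<eta> (h.pr X) * \<eta> (h.pr Y) \<and>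
      G (v.pr (\<phi> X)) (v.pr (\<phi> Y)) = - G (v.pr X) (v.pr Y) + \<eta> (v.pr X) * \<eta> (v.pr Y)"
    using metric by (auto simp: almost_paracontact_metric_Finsler_def defs)
  have phi: "tensor11 ?A \<phi>" and eta: "one_form ?A \<eta>" and xi: "\<xi> \<in> tvfields B"
    and phi_h: "\<And>X. X \<in> sections ?A H \<Longrightarrow> \<phi> X \<in> sections ?A H"
    and phi_v: "\<And>X. X \<in> sections ?A ?V \<Longrightarrow> \<phi> X \<in> sections ?A ?V"
    and phi_phi: "\<And>X. X \<in> tvfields B \<Longrightarrow> \<phi> (\<phi> X) =
        X - \<eta> (h.pr X) \<odot> h.pr \<xi> - \<eta> (v.pr X) \<odot> v.pr \<xi>"
    and eta_xi: "\<eta> (h.pr (h.pr \<xi>)) = 1" "\<eta> (v.pr (v.pr \<xi>)) = 1"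
    using apf unfolding almost_paracontact_Finsler_def defs by blast+
  have G: "tensor02 ?A G" and G_sym: "\<And>X Y. X \<in> tvfields B \<Longrightarrow> Y \<in> tvfields B \<Longrightarrow> G X Y = G Y X"
    and nondeg: "nondegenerate_on ?A H (\<lambda>X Y. G (h.pr X) (h.pr Y))"
      "nondegenerate_on ?A ?V (\<lambda>X Y. G (v.pr X) (v.pr Y))"
    using pm unfolding pseudo_metric_structure_def GH_def [abs_def] GV_def [abs_def] defs by blast+
  have D: "linear_connection ?A D"
    and D_pr: "\<And>X Y. X \<in> tvfields B \<Longrightarrow> Y \<in> tvfields B \<Longrightarrow>
      h.pr (D X Y) = D X (h.pr Y) \<and> v.pr (D X Y) = D X (v.pr Y)"
    and D_metrical: "\<And>X Y W. X \<in> tvfields B \<Longrightarrow> Y \<in> tvfields B \<Longrightarrow> W \<in> tvfields B \<Longrightarrow>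
      cov_deriv02 D X G Y W = 0"
    and D_sym: "\<And>X Y. X \<in> tvfields B \<Longrightarrow> Y \<in> tvfields B \<Longrightarrow>
      h.pr (tbracket B (h.pr X) (h.pr Y)) = D (h.pr X) (h.pr Y) - D (h.pr Y) (h.pr X) \<and>
      v.pr (tbracket B (v.pr X) (v.pr Y)) = D (v.pr X) (v.pr Y) - D (v.pr Y) (v.pr X)"
    using assms(4) unfolding Finsler_connection_def d_connection_def metrical_connection_def
      symmetric_connection_def cov_deriv11_def defs
    by (simp_all only: right_minus_eq)
  \<comment> \<open>the term of \<open>\<phi>\<^sup>2 X\<close> that belongs to the other summand vanishes when \<open>X\<close> is a section of one summand\<close>
  have eta0: "\<eta> 0 \<odot> X = 0" for X :: "'e vfield"
    by (simp add: one_form_linear(3)[OF h.atlas eta] fscale_def fun_eq_iff)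
  interpret hs: paracontact_subbundle ?A H ?V \<phi> \<eta> "h.pr \<xi>" G D
  proof (unfold_locales, goal_cases)
    case (7 X) then show ?case using phi_phi[of X] by (simp add: eta0)
  next
    case (10 X Y) then show ?case using G_phi[of X Y] phi_h by simp
  next
    case (11 X Y) then show ?case using d_eta[of X Y] by simp
  next
    case (15 X Y) then show ?case using D_sym[of X Y] by simp
  qed (use phi eta xi G eta_xi phi_h G_sym nondeg D D_metrical D_pr in simp_all)
  interpret vs: paracontact_subbundle ?A ?V H \<phi> \<eta> "v.pr \<xi>" G D
  proof (unfold_locales, goal_cases)
    case (7 X) then show ?case using phi_phi[of X] by (simp add: eta0)
  next
    case (10 X Y) then show ?case using G_phi[of X Y] phi_v by simp
  next
    case (11 X Y) then show ?case using d_eta[of X Y] by simp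
  next
    case (15 X Y) then show ?case using D_sym[of X Y] by simp
  qed (use phi eta xi G eta_xi phi_v G_sym nondeg D D_metrical D_pr in simp_all)
  \<comment> \<open>the Killing criterion ranges over sections of one summand, the theorem over projections of arbitrary fields\<close>
  have vfields_sections:
    "(\<forall>X\<in>sections ?A H. R X) \<longleftrightarrow> (\<forall>X\<in>tvfields B. R (h.pr X))"
    "(\<forall>X\<in>sections ?A ?V. R X) \<longleftrightarrow> (\<forall>X\<in>tvfields B. R (v.pr X))" for R
    by (metis h.pr_sections h.pr_id h.sections_vfields, metis v.pr_sections v.pr_id v.sections_vfields)
  have idem: "h.pr (h.pr X) = h.pr X" "v.pr (v.pr X) = v.pr X" if "X \<in> tvfields B" for X
    using that by simp_all
  have br: "tbracket B X Y \<in> tvfields B" if "X \<in> tvfields B" "Y \<in> tvfields B" for X Y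
    by (rule lie_bracket_vfield[OF h.atlas that])
  have "K_paracontact_Finsler B H \<phi> \<eta> \<xi> G \<longleftrightarrow>
      Killing ?A (h.pr \<xi>) (\<lambda>X Y. G (h.pr X) (h.pr Y)) \<and>
      Killing ?A (v.pr \<xi>) (\<lambda>X Y. G (v.pr X) (v.pr Y))"
    using assms(3) by (simp add: K_paracontact_Finsler_def Killing_def lie_deriv02_def defs)
  then show ?thesis
    unfolding hs.Killing_iff vs.Killing_iff vfields_sections defs
    using xi by (auto simp: idem br)
qed

end
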